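(* Let $I=[0,1]$, let $L:\mathbb{R}\times\mathbb{R}\to[0,+\infty]$ be a Borel function, and let $F(y)=\int_0^1L(y(t),y'(t))\,dt$ for $y\in W^{1,1}(I)$. Suppose that there exist two locally Lipschitz functions $\rho^-,\rho^+:\mathbb{R}\to\mathbb{R}$ such that $$\forall z\in\mathbb{R}\qquad \rho^-(z)<0,\quad \rho^+(z)>0,$$ and, for every bounded interval $J$ of $\mathbb{R}$, $$\sup_{z\in J}L\big(z,\rho^-(z)\big)<+\infty,\qquad \sup_{z\in J}L\big(z,\rho^+(z)\big)<+\infty.$$ Then the Lavrentiev phenomenon does not occur for the problem of minimizing $F(y)$ among $y\in W^{1,1}(I)$ with $y(0)=0$; that is, $$\inf\{F(y): y\in W^{1,1}(I),\ y(0)=0\}=\inf\{F(y): y\in\operatorname{Lip}(I),\ y(0)=0\}.$$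
   Context: $W^{1,1}(I)$ denotes the space of absolutely continuous functions $y:I\to\mathbb{R}$ (with $y'\in L^1(I)$), and $\operatorname{Lip}(I)$ denotes the space of Lipschitz functions $I\to\mathbb{R}$. The integral defining $F$ takes values in $[0,+\infty]$. *)

theory Defs
  imports "HOL-Analysis.Analysis"
begin

text \<open>
  A function \<open>I \<rightarrow> \<real>\<close> on a compact interval \<open>I\<close> is represented by a total function
  \<^typ>\<open>real \<Rightarrow> real\<close>. None of the notions below depends on its values outside \<open>I\<close>:
  these can affect \<^const>\<open>deriv\<close> only at the two endpoints, a null set.
\<close>

text \<open>The finite families of non-overlapping closed subintervals of \<open>I\<close> are the divisions \<open>d\<close> of
  subsets \<open>S\<close> of \<open>I\<close>; a member \<open>{a..b}\<close> has \<open>Inf = a\<close> and \<open>Sup = b\<close>.\<close>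

definition abs_continuous_on :: "real set \<Rightarrow> (real \<Rightarrow> real) \<Rightarrow> bool" where
  "abs_continuous_on I y \<longleftrightarrow>
     (\<forall>\<epsilon>>0. \<exists>\<delta>>0. \<forall>d S. d division_of S \<and> S \<subseteq> I \<and> (\<Sum>k\<in>d. Sup k - Inf k) < \<delta> \<longrightarrow>
        (\<Sum>k\<in>d. \<bar>y (Sup k) - y (Inf k)\<bar>) < \<epsilon>)"

text \<open>The last two conditions spell out \<open>y' \<in> L\<^sup>1(I)\<close>; by Lebesgue's theorem they follow
  from absolute continuity when \<open>I\<close> is a compact interval.\<close>

definition W11 :: "real set \<Rightarrow> (real \<Rightarrow> real) set" where
  "W11 I = {y. abs_continuous_on I y \<and>
               (AE t in lebesgue_on I. y differentiable (at t)) \<and>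
               integrable (lebesgue_on I) (deriv y)}"

definition Lip :: "real set \<Rightarrow> (real \<Rightarrow> real) set" where
  "Lip I = {y. \<exists>C. C-lipschitz_on I y}"

definition action :: "(real \<times> real \<Rightarrow> ennreal) \<Rightarrow> (real \<Rightarrow> real) \<Rightarrow> ennreal" where
  "action L y = (\<integral>\<^sup>+ t. L (y t, deriv y t) \<partial>lebesgue_on {0..1})"

end

theory Submission
  imports Defs
begin

text \<open>
  Given an absolutely continuous \<open>y\<close>, change time where it is fast: the new time \<open>s\<close> has \<open>s' = g\<close>, where
  \<open>g = y' / \<rho>(y) \<ge> 1\<close> on \<open>A = {\<bar>y'\<bar> > n}\<close>, \<open>\<rho>\<close> being the one of \<open>\<rho>m\<close>, \<open>\<rho>p\<close> with the sign of \<open>y'\<close>,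
  and \<open>g = 1\<close> off \<open>A\<close>. The reparametrized curve has velocity \<open>\<rho>\<close> on the image of \<open>A\<close>, so it is
  Lipschitz, and its action exceeds that of \<open>y\<close> by at most a constant times the integral of \<open>\<bar>y'\<bar>\<close>
  over \<open>A\<close>, which tends to \<open>0\<close> as \<open>n\<close> grows. It lives on a time interval containing \<open>[0,1]\<close>; since the
  right endpoint is free and \<open>L \<ge> 0\<close>, it can be cut off at time \<open>1\<close>.
\<close>

subsection \<open>Almost everywhere differentiation\<close>

text \<open>On the intervals witnessing the failure of differentiability up to \<open>1 / Suc n\<close>, the Riemann sum is
  off by a proportional amount. By Vitali, disjoint ones cover almost all bad points, so Henstock's lemma
  bounds the outer measure of the bad set by any \<open>e > 0\<close>.\<close>

lemma negligible_not_derivative_integral: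
  fixes f :: "real \<Rightarrow> real"
  assumes "f integrable_on {a..b}"
  shows "negligible {x \<in> {a<..<b}. \<not> ((\<lambda>u. integral {a..u} f) has_real_derivative f x) (at x)}"
proof -
  define F where "F u = integral {a..u} f" for u
  \<comment> \<open>Level \<open>n\<close> of the failure: the error exceeds
    \<open>1 / Suc n\<close> of the distance at arbitrarily small scales. Every bad point lies in
    some \<open>E n\<close>, so it suffices that each level is negligible.\<close>
  define E where "E n = {x \<in> {a<..<b}. \<forall>d>0. \<exists>y. y \<noteq> x \<and> \<bar>y - x\<bar> < d \<and>
    \<bar>F y - F x - f x * (y - x)\<bar> > \<bar>y - x\<bar> / real (Suc n)}" for n
  have F_diff: "integral {u..v} f = F v - F u" if "a \<le> u" "u \<le> v" "v \<le> b" for u v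
  proof -
    have "f integrable_on {a..v}"
      using assms that by (auto intro: integrable_on_subinterval)
    from Henstock_Kurzweil_Integration.integral_combine[OF that(1,2) this] show ?thesis by (simp add: F_def)
  qed
  have "negligible (E n)" for n
    unfolding negligible_outer_le
  proof (intro allI impI)
    fix e :: real assume "e > 0"
    then have e: "e / real (Suc n) > 0" by simp
    have "f integrable_on cbox a b" using assms by simp
    from Henstock_lemma[OF this e] obtain \<gamma> where "gauge \<gamma>"
      and \<gamma>: "\<And>p. \<lbrakk>p tagged_partial_division_of (cbox a b); \<gamma> fine p\<rbrakk> \<Longrightarrow>
             sum (\<lambda>(x,k). norm(measure lborel k *\<^sub>R f x - integral k f)) p < e / real (Suc n)"
      by blast
    \<comment> \<open>An index carries a tag \<open>x\<close>, a centre and a radius, since Vitali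
      selects balls by index while Henstock needs the tag. Containment in \<open>\<gamma> x\<close>
      makes any disjoint selection fine; the last condition makes its Riemann term off by at least
      the length over \<open>Suc n\<close>.\<close>
    define K where "K = {(x, c, r). x \<in> E n \<and> r > 0 \<and> x \<in> cball c r \<and> cball c r \<subseteq> {a<..<b} \<inter> \<gamma> x \<and>
       \<bar>integral (cball c r) f - 2 * r * f x\<bar> > 2 * r / real (Suc n)}"
    define cen :: "real \<times> real \<times> real \<Rightarrow> real" where "cen i = fst (snd i)" for i
    define rad :: "real \<times> real \<times> real \<Rightarrow> real" where "rad i = snd (snd i)" for i
    have cover: "\<exists>i. i \<in> K \<and> x \<in> cball (cen i) (rad i) \<and> rad i < d" if xE: "x \<in> E n" and d: "0 < d" for x d
    proof -
      have x: "a < x" "x < b" using that by (auto simp: E_def)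
      then have "open ({a<..<b} \<inter> \<gamma> x)" "x \<in> {a<..<b} \<inter> \<gamma> x"
        using \<open>gauge \<gamma>\<close> by (auto simp: gauge_def)
      then obtain \<eta> where \<eta>: "\<eta> > 0" "ball x \<eta> \<subseteq> {a<..<b} \<inter> \<gamma> x"
        using open_contains_ball_eq by blast
      obtain y where y: "y \<noteq> x" "\<bar>y - x\<bar> < min d \<eta>"
        "\<bar>F y - F x - f x * (y - x)\<bar> > \<bar>y - x\<bar> / real (Suc n)"
      proof (atomize_elim)
        have "min d \<eta> > 0" using \<eta>(1) d by simp
        moreover have "\<forall>d>0. \<exists>y. y \<noteq> x \<and> \<bar>y - x\<bar> < d \<and>
            \<bar>F y - F x - f x * (y - x)\<bar> > \<bar>y - x\<bar> / real (Suc n)"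
          using xE unfolding E_def by blast
        ultimately show "\<exists>y. y \<noteq> x \<and> \<bar>y - x\<bar> < min d \<eta> \<and> \<bar>y - x\<bar> / real (Suc n) < \<bar>F y - F x - f x * (y - x)\<bar>" by blast
      qed
      \<comment> \<open>The interval between \<open>x\<close> and \<open>y\<close> is written as a
        ball, the shape the Vitali theorem covers with; \<open>x\<close> is one of its
        endpoints.\<close>
      define c where "c = (x + y) / 2"
      define r where "r = \<bar>y - x\<bar> / 2"
      have cb: "cball c r = {min x y..max x y}"
        by (auto simp: cball_eq_atLeastAtMost c_def r_def abs_if min_def max_def field_simps)
      also have "\<dots> \<subseteq> ball x \<eta>" using y by (auto simp: dist_real_def)
      finally have sub: "cball c r \<subseteq> {a<..<b} \<inter> \<gamma> x" using \<eta> by auto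
      have "min x y \<in> cball c r" "max x y \<in> cball c r" unfolding cb by auto
      then have mm: "a \<le> min x y" "max x y \<le> b" using sub by auto
      have "integral (cball c r) f = F (max x y) - F (min x y)"
        unfolding cb by (rule F_diff) (use mm in auto)
      moreover have "2 * r = \<bar>y - x\<bar>" by (simp add: r_def)
      ultimately have int: "integral (cball c r) f - 2 * r * f x = F (max x y) - F (min x y) - \<bar>y - x\<bar> * f x"
        by simp
      have "\<bar>integral (cball c r) f - 2 * r * f x\<bar> = \<bar>F y - F x - f x * (y - x)\<bar>"
      proof (cases "x \<le> y")
        case True
        then show ?thesis unfolding int by (simp add: mult.commute)
      next
        case False
        then have "integral (cball c r) f - 2 * r * f x = - (F y - F x - f x * (y - x))"
          unfolding int by (simp add: algebra_simps)
        then show ?thesis by (simp only: abs_minus_cancel)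
      qed
      then have "(x, c, r) \<in> K"
        using sub y xE cb by (auto simp: K_def r_def)
      moreover have "x \<in> cball c r" unfolding cb by auto
      moreover have "r < d" using y by (auto simp: r_def)
      ultimately show ?thesis by (intro exI[of _ "(x, c, r)"]) (auto simp: cen_def rad_def)
    qed
    have pos: "\<And>i. i \<in> K \<Longrightarrow> 0 < rad i" by (auto simp: K_def rad_def)
    obtain C where C: "countable C" "C \<subseteq> K"
     "pairwise (\<lambda>i j. disjnt (cball (cen i) (rad i)) (cball (cen j) (rad j))) C"
     "negligible(E n - (\<Union>i \<in> C. cball (cen i) (rad i)))"
      using Vitali_covering_theorem_cballs[of K rad "E n" cen, OF pos cover] by blast
    have K_Icc: "cball (cen i) (rad i) \<subseteq> cbox a b" if "i \<in> K" for i
    proof -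
      have "cball (cen i) (rad i) \<subseteq> {a<..<b}" using that by (auto simp: K_def cen_def rad_def)
      then show ?thesis by (auto simp: subset_eq less_imp_le)
    qed
    let ?B = "\<lambda>i. cball (cen i) (rad i)"
    have fin: "measure lebesgue (\<Union>i\<in>D. ?B i) \<le> e" if D: "D \<subseteq> C" "finite D" for D
    proof -
      let ?p = "(\<lambda>i. (fst i, ?B i)) ` D"
      have DK: "i \<in> K" if "i \<in> D" for i using that D C by auto
      have K_props: "fst i \<in> ?B i" "?B i \<subseteq> {a..b}" "?B i \<subseteq> \<gamma> (fst i)" "0 < rad i"
        "\<bar>integral (?B i) f - 2 * rad i * f (fst i)\<bar> > 2 * rad i / real (Suc n)" if "i \<in> D" for i
        using DK[OF that] by (auto simp: K_def cen_def rad_def)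
      have disj: "?B i \<inter> ?B j = {}" if "i \<in> D" "j \<in> D" "i \<noteq> j" for i j
        using C(3) D that by (auto simp: pairwise_def disjnt_def)
      have "?p tagged_partial_division_of (cbox a b)"
        unfolding tagged_partial_division_of_def
      proof (intro conjI allI impI)
        show "finite ?p" using D by simp
      next
        fix x k assume "(x, k) \<in> ?p"
        then obtain i where i: "i \<in> D" "x = fst i" "k = ?B i" by auto
        show "x \<in> k" "k \<subseteq> cbox a b" using i K_props[OF i(1)] by auto
        show "\<exists>u v. k = cbox u v" using i by (auto simp: cball_eq_atLeastAtMost box_real)
      next
        fix x1 k1 x2 k2 assume "(x1, k1) \<in> ?p \<and> (x2, k2) \<in> ?p \<and> (x1, k1) \<noteq> (x2, k2)"
        then show "interior k1 \<inter> interior k2 = {}"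
          using disj interior_subset by blast
      qed
      moreover have "\<gamma> fine ?p" using K_props by (auto simp: fine_def)
      ultimately have *: "sum (\<lambda>(x,k). norm(measure lborel k *\<^sub>R f x - integral k f)) ?p < e / real (Suc n)"
        by (rule \<gamma>)
      have inj: "inj_on (\<lambda>i. (fst i, ?B i)) D"
        using disj K_props(1) by (fastforce simp: inj_on_def)
      \<comment> \<open>Each ball contributes at least its length over \<open>Suc n\<close> to the
        Henstock sum. The tolerance \<open>e / real (Suc n)\<close> was chosen so that this factor
        cancels and the total length stays below \<open>e\<close>.\<close>
      have "(\<Sum>i\<in>D. 2 * rad i / real (Suc n)) \<le> (\<Sum>i\<in>D. norm(measure lborel (?B i) *\<^sub>R f (fst i) - integral (?B i) f))"
      proof (rule sum_mono)
        fix i assume i: "i \<in> D"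
        have "measure lborel (?B i) = 2 * rad i"
          using K_props(4)[OF i] by (simp add: cball_eq_atLeastAtMost)
        then show "2 * rad i / real (Suc n) \<le> norm(measure lborel (?B i) *\<^sub>R f (fst i) - integral (?B i) f)"
          using K_props(5)[OF i] by (simp add: abs_minus_commute)
      qed
      also have "\<dots> < e / real (Suc n)"
        using * by (simp add: sum.reindex[OF inj] o_def)
      finally have **: "(\<Sum>i\<in>D. 2 * rad i) < e"
        by (simp add: sum_divide_distrib[symmetric] divide_less_cancel)
      have "measure lebesgue (\<Union>i\<in>D. ?B i) \<le> (\<Sum>i\<in>D. measure lebesgue (?B i))"
        using D by (intro measure_UNION_le) auto
      also have "\<dots> = (\<Sum>i\<in>D. 2 * rad i)"
        by (rule sum.cong) (use K_props(4) in \<open>auto simp: cball_eq_atLeastAtMost intro: less_imp_le\<close>)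
      finally show ?thesis using ** by linarith
    qed
    have meas: "(\<Union>i\<in>C. ?B i) \<in> lmeasurable"
    proof (rule fmeasurable_UN[where A="cbox a b"])
      show "?B i \<subseteq> cbox a b" if "i \<in> C" for i using that C(2) K_Icc by blast
    qed (use C(1) in auto)
    \<comment> \<open>Henstock's lemma controls finite families only; the countable union is
      approximated in measure by finite subunions, so the bound \<open>e\<close> passes to
      it.\<close>
    have le: "measure lebesgue (\<Union>i\<in>C. ?B i) \<le> e"
    proof (rule field_le_epsilon)
      fix \<delta> :: real assume "\<delta> > 0"
      obtain D' where D': "D' \<subseteq> ?B ` C" "finite D'" "measure lebesgue (\<Union>(?B ` C)) - \<delta> < measure lebesgue (\<Union>D')"
      proof (rule measure_countable_Union_approachable[of "?B ` C" \<delta> e])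
        fix D' assume "D' \<subseteq> ?B ` C" "finite D'"
        then obtain D where "D \<subseteq> C" "finite D" "D' = ?B ` D" by (meson finite_subset_image)
        then show "measure lebesgue (\<Union>D') \<le> e" using fin by auto
      qed (use C \<open>\<delta> > 0\<close> in auto)
      then obtain D where "D \<subseteq> C" "finite D" "D' = ?B ` D" by (meson finite_subset_image)
      with D' fin[of D] show "measure lebesgue (\<Union>i\<in>C. ?B i) \<le> e + \<delta>" by auto
    qed
    let ?N = "E n - (\<Union>i\<in>C. ?B i)"
    show "\<exists>T. E n \<subseteq> T \<and> T \<in> lmeasurable \<and> measure lebesgue T \<le> e"
    proof (intro exI conjI)
      show "E n \<subseteq> ?N \<union> (\<Union>i\<in>C. ?B i)" by auto
      show "?N \<union> (\<Union>i\<in>C. ?B i) \<in> lmeasurable"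
        using meas C(4) negligible_imp_measurable by blast
      have "measure lebesgue (?N \<union> (\<Union>i\<in>C. ?B i)) \<le> measure lebesgue ?N + measure lebesgue (\<Union>i\<in>C. ?B i)"
        using meas C(4) negligible_imp_measurable by (intro measure_Un_le) blast+
      then show "measure lebesgue (?N \<union> (\<Union>i\<in>C. ?B i)) \<le> e"
        using le C(4) negligible_imp_measure0 by fastforce
    qed
  qed
  then have "negligible (\<Union>n. E n)" by (rule negligible_Union_nat)
  moreover have "{x \<in> {a<..<b}. \<not> (F has_real_derivative f x) (at x)} \<subseteq> (\<Union>n. E n)"
  proof
    fix x assume x: "x \<in> {x \<in> {a<..<b}. \<not> (F has_real_derivative f x) (at x)}"
    then obtain \<epsilon> where \<epsilon>: "\<epsilon> > 0" "\<And>d. d > 0 \<Longrightarrow> \<exists>y. \<bar>y - x\<bar> < d \<and> \<bar>F y - F x - f x * (y - x)\<bar> > \<epsilon> * \<bar>y - x\<bar>"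
      unfolding has_field_derivative_def has_derivative_at_alt
      by (auto simp: bounded_linear_mult_right not_le)
    obtain n where n: "1 / real (Suc n) < \<epsilon>" using nat_approx_posE \<epsilon>(1) by blast
    have "x \<in> E n" unfolding E_def
    proof (clarsimp, intro conjI allI impI)
      show "a < x" "x < b" using x by auto
      fix d :: real assume "d > 0"
      then obtain y where y: "\<bar>y - x\<bar> < d" "\<bar>F y - F x - f x * (y - x)\<bar> > \<epsilon> * \<bar>y - x\<bar>"
        using \<epsilon>(2) by blast
      have "\<bar>y - x\<bar> * (1 / real (Suc n)) \<le> \<bar>y - x\<bar> * \<epsilon>" using n by (intro mult_left_mono) auto
      then show "\<exists>y. y \<noteq> x \<and> \<bar>y - x\<bar> < d \<and> \<bar>y - x\<bar> / (1 + real n) < \<bar>F y - F x - f x * (y - x)\<bar>"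
        using y by (intro exI[of _ y]) (auto simp: mult.commute)
    qed
    then show "x \<in> (\<Union>n. E n)" by blast
  qed
  ultimately show ?thesis unfolding F_def by (rule negligible_subset)
qed

section \<open>Lipschitz functions as indefinite integrals\<close>

lemma nn_integral_Icc_has_integral:
  fixes f :: "real \<Rightarrow> real"
  assumes [measurable]: "f \<in> borel_measurable borel" and nn: "\<And>x. 0 \<le> f x"
    and eq: "(\<integral>\<^sup>+x. ennreal (f x) * indicator {a..b} x \<partial>lborel) = ennreal r" and "0 \<le> r"
  shows "(f has_integral r) {a..b}"
proof -
  have "has_bochner_integral lborel (\<lambda>x. f x * indicator {a..b} x) r"
  proof (rule has_bochner_integral_nn_integral)
    have "(\<integral>\<^sup>+x. ennreal (f x * indicator {a..b} x) \<partial>lborel) = (\<integral>\<^sup>+x. ennreal (f x) * indicator {a..b} x \<partial>lborel)"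
      by (intro nn_integral_cong) (auto split: split_indicator)
    then show "(\<integral>\<^sup>+x. ennreal (f x * indicator {a..b} x) \<partial>lborel) = ennreal r" using eq by simp
  qed (use nn \<open>0 \<le> r\<close> in auto)
  then have "((\<lambda>x. f x * indicator {a..b} x) has_integral r) UNIV"
    using has_integral_integral_lborel has_bochner_integral_iff by metis
  also have "(\<lambda>x. f x * indicator {a..b} x) = (\<lambda>x. if x \<in> {a..b} then f x else 0)"
    by (auto split: split_indicator)
  finally show ?thesis by (simp only: has_integral_restrict_UNIV)
qed

text \<open>Adding \<open>2 D x\<close> makes \<open>f\<close> bi-Lipschitz; the push-forward of Lebesgue measure under the inverse is then
  absolutely continuous, and its Radon-Nikodym density is the derivative of the sum.\<close>

lemma lipschitz_indefinite_integral:
  fixes f :: "real \<Rightarrow> real"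
  assumes f: "C-lipschitz_on UNIV f"
  obtains u where "\<And>a b. a \<le> b \<Longrightarrow> u absolutely_integrable_on {a..b}"
    "\<And>a b. a \<le> b \<Longrightarrow> (u has_integral (f b - f a)) {a..b}"
proof -
  \<comment> \<open>The \<open>+ 1\<close> keeps \<open>D\<close> positive when
    \<open>C = 0\<close>. All slopes of \<open>F\<close> then lie between \<open>D\<close> and
    \<open>3 * D\<close>.\<close>
  define D where "D = C + 1"
  have D: "D > 0" "C < D" using lipschitz_on_nonneg[OF f] by (auto simp: D_def)
  define F where "F x = f x + 2 * D * x" for x
  have bound: "D * (y - x) \<le> F y - F x" "F y - F x \<le> 3 * D * (y - x)" if "x \<le> y" for x y
  proof -
    have "\<bar>f y - f x\<bar> \<le> C * \<bar>y - x\<bar>" using lipschitz_onD[OF f, of y x] by (simp add: dist_real_def)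
    also have "\<dots> \<le> D * \<bar>y - x\<bar>" using D by (intro mult_right_mono) auto
    also have "\<dots> = D * (y - x)" using that by simp
    finally have "\<bar>f y - f x\<bar> \<le> D * (y - x)" .
    then show "D * (y - x) \<le> F y - F x" "F y - F x \<le> 3 * D * (y - x)"
      by (auto simp: F_def algebra_simps)
  qed
  have sm: "strict_mono F"
  proof (rule strict_monoI)
    fix x y :: real assume "x < y"
    then have "0 < D * (y - x)" using D by simp
    then show "F x < F y" using bound(1)[of x y] \<open>x < y\<close> by simp
  qed
  have Flip: "\<bar>F y - F x\<bar> \<le> 3 * D * \<bar>y - x\<bar>" for x y
    using bound[of x y] bound[of y x] D by (cases "x \<le> y") (auto simp: abs_if algebra_simps mult_left_mono)
  have contF: "continuous_on UNIV F"
    using lipschitz_on_continuous_on[OF f] unfolding F_def by (auto intro!: continuous_intros)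
  have "surj F"
    unfolding surj_def
  proof
    fix z
    have "D * ((\<bar>z - F 0\<bar> / D) - 0) \<le> F (\<bar>z - F 0\<bar> / D) - F 0" using D by (intro bound) auto
    then have 1: "z \<le> F (\<bar>z - F 0\<bar> / D)" using D by simp
    have "D * (0 - (- (\<bar>z - F 0\<bar> / D))) \<le> F 0 - F (- (\<bar>z - F 0\<bar> / D))" using D by (intro bound) auto
    then have 2: "F (- (\<bar>z - F 0\<bar> / D)) \<le> z" using D by simp
    have "- (\<bar>z - F 0\<bar> / D) \<le> \<bar>z - F 0\<bar> / D" using D by simp
    then show "\<exists>x. z = F x"
      using IVT'[OF 2 1 _ continuous_on_subset[OF contF]] by auto
  qed
  define G where "G = inv F"
  have FG: "F (G x) = x" for x using \<open>surj F\<close> by (simp add: G_def surj_f_inv_f)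
  have GF: "G (F x) = x" for x using strict_mono_imp_inj_on[OF sm] by (simp add: G_def inv_f_f)
  have less: "G x \<le> t \<longleftrightarrow> x \<le> F t" "t \<le> G x \<longleftrightarrow> F t \<le> x" for t x
    using strict_mono_less_eq[OF sm] FG by metis+
  have "mono G" by (rule monoI) (simp add: less FG)
  then have [measurable]: "G \<in> borel_measurable borel" by (rule borel_measurable_mono)
  have [measurable]: "G \<in> lborel \<rightarrow>\<^sub>M borel" by simp
  \<comment> \<open>Since \<open>G\<close> inverts \<open>F\<close>, this measure gives a set
    \<open>N\<close> the length of its image under \<open>F\<close>. Intervals get the increment of
    \<open>F\<close>, and null sets stay null because \<open>F\<close> is Lipschitz.\<close>
  define \<nu> where "\<nu> = distr lborel borel G"
  have "absolutely_continuous lborel \<nu>"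
    unfolding absolutely_continuous_def
  proof
    fix N :: "real set" assume N: "N \<in> null_sets lborel"
    then have [measurable]: "N \<in> sets borel" by auto
    have "negligible N" using N by (simp add: negligible_iff_null_sets null_sets_completionI)
    then have "negligible (F ` N)"
      by (rule negligible_locally_Lipschitz_image[rotated]) (use Flip in \<open>auto intro!: exI[of _ UNIV] exI[of _ "3 * D"]\<close>)
    moreover have "F ` N = G -` N" by (auto simp: GF) (metis FG imageI)
    moreover have "G -` N \<in> sets borel" using measurable_sets[OF \<open>G \<in> borel_measurable borel\<close>] by force
    ultimately have "G -` N \<in> null_sets lborel"
      by (simp add: negligible_iff_null_sets null_sets_completion_iff)
    then show "N \<in> null_sets \<nu>"
      unfolding \<nu>_def by (subst null_sets_distr_iff) auto
  qed
  then obtain U where U[measurable]: "U \<in> borel_measurable lborel" and dens: "density lborel U = \<nu>"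
    using sigma_finite_measure.Radon_Nikodym[OF sigma_finite_lborel] unfolding \<nu>_def by (metis sets_distr sets_lborel)
  \<comment> \<open>\<open>U\<close> may take the value \<infinity>, but its integral over a compact
    interval is an increment of \<open>F\<close>, so it is finite almost everywhere and the real
    version has the same integrals.\<close>
  define w where "w x = enn2real (U x)" for x
  have [measurable]: "w \<in> borel_measurable borel" using U unfolding w_def by simp
  have w: "(w has_integral (F b - F a)) {a..b}" if "a \<le> b" for a b
  proof (rule nn_integral_Icc_has_integral)
    have "F a \<le> F b" using strict_mono_less_eq[OF sm] that by simp
    then show "0 \<le> F b - F a" by simp
    have "(\<integral>\<^sup>+x. U x * indicator {a..b} x \<partial>lborel) = emeasure \<nu> {a..b}"
      unfolding dens[symmetric] by (simp add: emeasure_density)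
    also have "\<dots> = emeasure lborel (G -` {a..b})" unfolding \<nu>_def by (simp add: emeasure_distr)
    also have "G -` {a..b} = {F a..F b}" by (auto simp: less)
    also have "emeasure lborel \<dots> = ennreal (F b - F a)" using \<open>F a \<le> F b\<close> by simp
    finally have eq: "(\<integral>\<^sup>+x. U x * indicator {a..b} x \<partial>lborel) = ennreal (F b - F a)" .
    have "AE x in lborel. U x * indicator {a..b} x \<noteq> \<infinity>"
      by (rule nn_integral_noteq_infinite) (auto simp: eq)
    then have "AE x in lborel. ennreal (w x) * indicator {a..b} x = U x * indicator {a..b} x"
      by eventually_elim (auto simp: w_def split: split_indicator simp: less_top)
    then show "(\<integral>\<^sup>+x. ennreal (w x) * indicator {a..b} x \<partial>lborel) = ennreal (F b - F a)"
      using eq nn_integral_cong_AE by metis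
  qed (auto simp: w_def)
  show thesis
  \<comment> \<open>Subtracting the slope of the added linear term returns from \<open>F\<close> to
    \<open>f\<close>.\<close>
  proof (rule that[of "\<lambda>x. w x - 2 * D"])
    fix a b :: real assume ab: "a \<le> b"
    have "w absolutely_integrable_on {a..b}"
      using w[OF ab] by (intro nonnegative_absolutely_integrable_1) (auto simp: w_def)
    then show "(\<lambda>x. w x - 2 * D) absolutely_integrable_on {a..b}"
      by (intro set_integral_diff) (auto simp: absolutely_integrable_continuous_real)
    have "((\<lambda>x. w x - 2 * D) has_integral (F b - F a) - (b - a) *\<^sub>R (2 * D)) {a..b}"
      using w[OF ab] has_integral_const_real[of "2 * D" a b] ab by (intro has_integral_diff) auto
    then show "((\<lambda>x. w x - 2 * D) has_integral (f b - f a)) {a..b}"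
      by (simp add: F_def algebra_simps)
  qed
qed

subsection \<open>Absolutely continuous and Lipschitz functions\<close>

text \<open>A gauge proof: tags in \<open>N\<close> are confined to an open set of small measure, where absolute continuity
  bounds the increments of \<open>y\<close>.\<close>

lemma has_integral_derivative_abs_continuous:
  fixes y y' :: "real \<Rightarrow> real"
  assumes ac: "abs_continuous_on {a..b} y" and "a \<le> b" and N: "negligible N"
    and der: "\<And>x. x \<in> {a..b} - N \<Longrightarrow> (y has_real_derivative y' x) (at x)"
  shows "(y' has_integral (y b - y a)) {a..b}"
proof -
  \<comment> \<open>With value \<open>0\<close> on \<open>N\<close>, a tag in \<open>N\<close>
    contributes nothing to the Riemann sum, and only the increment of \<open>y\<close> over its
    interval has to be estimated.\<close>
  define f where "f x = (if x \<in> N then 0 else y' x)" for x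
  have "(f has_integral (y b - y a)) {a..b}"
    unfolding has_integral_real
  proof (intro allI impI)
    fix e :: real assume "e > 0"
    then have e2: "e / 2 > 0" by simp
    then obtain \<delta> where "\<delta> > 0" and \<delta>: "\<And>d S. d division_of S \<Longrightarrow> S \<subseteq> {a..b} \<Longrightarrow> (\<Sum>k\<in>d. Sup k - Inf k) < \<delta> \<Longrightarrow>
        (\<Sum>k\<in>d. \<bar>y (Sup k) - y (Inf k)\<bar>) < e / 2"
      using ac unfolding abs_continuous_on_def by meson
    have Nnull: "N \<in> null_sets lebesgue" using N by (simp add: negligible_iff_null_sets)
    then obtain U where U: "open U" "N \<subseteq> U" "(U - N) \<in> lmeasurable" "emeasure lebesgue (U - N) < ennreal \<delta>"
      using sets_lebesgue_outer_open[of N \<delta>] \<open>\<delta> > 0\<close> by blast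
    have Usets: "U \<in> sets lebesgue" using U(1) by (simp add: borel_open)
    have Ueq: "emeasure lebesgue U = emeasure lebesgue (U - N)"
      using emeasure_Diff_null_set[OF Nnull Usets] by simp
    then have Um: "U \<in> lmeasurable" "measure lebesgue U < \<delta>"
    proof -
      have "emeasure lebesgue U < ennreal \<delta>" using U(4) Ueq by simp
      then show U1: "U \<in> lmeasurable" using Usets by (intro fmeasurableI) (auto intro: less_trans)
      show "measure lebesgue U < \<delta>"
        using \<open>emeasure lebesgue U < ennreal \<delta>\<close> \<open>\<delta> > 0\<close> emeasure_eq_measure2[OF U1] by (simp add: ennreal_less_iff)
    qed
    \<comment> \<open>The \<open>+ 1\<close> avoids division by zero when \<open>a = b\<close> and
      makes the total linear error strictly less than half of \<open>e\<close>.\<close>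
    define \<epsilon> where "\<epsilon> = e / (2 * (b - a + 1))"
    have \<epsilon>: "\<epsilon> > 0" "\<epsilon> * (b - a) < e / 2"
      using \<open>e > 0\<close> \<open>a \<le> b\<close> by (auto simp: \<epsilon>_def field_simps)
    have "\<exists>d>0. x \<in> {a..b} - N \<longrightarrow> (\<forall>v. \<bar>v - x\<bar> < d \<longrightarrow> \<bar>y v - y x - y' x * (v - x)\<bar> \<le> \<epsilon> * \<bar>v - x\<bar>)" for x
    proof (cases "x \<in> {a..b} - N")
      case True
      with der[OF True] \<epsilon>(1) show ?thesis
        unfolding has_field_derivative_def has_derivative_at_alt by auto
    qed (auto intro: exI[of _ 1])
    then obtain d where d: "\<And>x. d x > 0" "\<And>x v. x \<in> {a..b} - N \<Longrightarrow> \<bar>v - x\<bar> < d x \<Longrightarrow> \<bar>y v - y x - y' x * (v - x)\<bar> \<le> \<epsilon> * \<bar>v - x\<bar>"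
      by metis
    define \<gamma> where "\<gamma> x = (if x \<in> N then U else ball x (d x))" for x
    have gauge: "gauge \<gamma>" using U d(1) by (auto simp: gauge_def \<gamma>_def)
    have close: "norm (sum (\<lambda>(x,k). measure lborel k *\<^sub>R f x) p - (y b - y a)) < e"
      if p: "p tagged_division_of {a..b}" and fine: "\<gamma> fine p" for p
    proof -
      have "finite p" using p by auto
      have pK: "\<exists>u v. K = {u..v} \<and> u \<le> v \<and> x \<in> {u..v} \<and> {u..v} \<subseteq> {a..b} \<and> {u..v} \<subseteq> \<gamma> x" if xK: "(x, K) \<in> p" for x K
      proof -
        obtain u v where K: "K = cbox u v" using tagged_division_ofD(4)[OF p xK] by blast
        moreover have "x \<in> K" "K \<subseteq> {a..b}" using tagged_division_ofD(2,3)[OF p that] by auto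
        moreover have "K \<subseteq> \<gamma> x" using fine that by (auto simp: fine_def)
        ultimately show ?thesis by (intro exI[of _ u] exI[of _ v]) auto
      qed
      define h where "h K = \<bar>y (Sup K) - y (Inf K)\<bar>" for K
      define l where "l K = Sup K - Inf K" for K :: "real set"
      define q where "q = {z \<in> p. fst z \<in> N}"
      have q: "q tagged_partial_division_of {a..b}"
        by (rule tagged_partial_division_subset[of p]) (use p in \<open>auto simp: q_def tagged_division_of_def\<close>)
      have q_ivl: "\<exists>u v. snd z = {u..v} \<and> u \<le> v" if "z \<in> q" for z
      proof -
        have "(fst z, snd z) \<in> p" using that by (simp add: q_def)
        from pK[OF this] show ?thesis by blast
      qed
      have q_disj: "interior (snd z) \<inter> interior (snd w) = {}" if "z \<in> q" "w \<in> q" "z \<noteq> w" for z w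
        using tagged_partial_division_ofD(5)[OF q, of "fst z" "snd z" "fst w" "snd w"] that by simp
      \<comment> \<open>Absolute continuity speaks of a set of intervals, the Riemann sum of tagged
        ones. Two tags can share an interval only if it is a single point, where \<open>g\<close>
        vanishes, so both sums agree.\<close>
      have reindex: "sum g (snd ` q) = (\<Sum>z\<in>q. g (snd z))" if "\<And>u. g {u} = 0" for g :: "real set \<Rightarrow> real"
      proof (subst sum.reindex_nontrivial)
        fix z w assume zw: "z \<in> q" "w \<in> q" "z \<noteq> w" "snd z = snd w"
        then have "interior (snd z) \<inter> interior (snd w) = {}"
          by (intro q_disj)
        moreover obtain u v where "snd z = {u..v}" "u \<le> v" using q_ivl[OF zw(1)] by blast
        ultimately have "snd z = {u}" using zw by auto
        then show "g (snd z) = 0" using that by simp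
      qed (use \<open>finite p\<close> in \<open>auto simp: q_def o_def\<close>)
      \<comment> \<open>The interiors are disjoint and lie in \<open>U\<close>, because tags in
        \<open>N\<close> have gauge \<open>U\<close>. Their total length is thus below
        \<open>\<delta>\<close>, as absolute continuity requires.\<close>
      have "(\<Sum>z\<in>q. l (snd z)) = (\<Sum>z\<in>q. measure lebesgue (interior (snd z)))"
      proof (rule sum.cong)
        fix z assume "z \<in> q"
        then obtain u v where "snd z = {u..v}" "u \<le> v" using q_ivl by blast
        then show "l (snd z) = measure lebesgue (interior (snd z))" by (simp add: l_def)
      qed simp
      also have "\<dots> = measure lebesgue (\<Union>z\<in>q. interior (snd z))"
      proof (rule measure_negligible_finite_Union_image[symmetric])
        show "finite q" using \<open>finite p\<close> by (simp add: q_def)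
        show "interior (snd z) \<in> lmeasurable" if zq: "z \<in> q" for z
        proof -
          obtain u v where "snd z = {u..v}" using q_ivl[OF zq] by (auto simp: q_def)
          then show ?thesis by (simp add: lmeasurable_open)
        qed
        show "pairwise (\<lambda>z w. negligible (interior (snd z) \<inter> interior (snd w))) q"
          unfolding pairwise_def by (simp add: q_disj)
      qed
      also have "\<dots> \<le> measure lebesgue U"
      proof (rule measure_mono_fmeasurable)
        show "(\<Union>z\<in>q. interior (snd z)) \<subseteq> U"
        proof
          fix t assume "t \<in> (\<Union>z\<in>q. interior (snd z))"
          then obtain z where z: "z \<in> q" "t \<in> snd z" using interior_subset by blast
          then have "fst z \<in> N" "(fst z, snd z) \<in> p" by (auto simp: q_def)
          then show "t \<in> U" using pK[OF \<open>(fst z, snd z) \<in> p\<close>] z by (auto simp: \<gamma>_def)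
        qed
        show "(\<Union>z\<in>q. interior (snd z)) \<in> sets lebesgue"
          by (simp add: borel_open open_UN)
      qed (use Um in auto)
      finally have "(\<Sum>z\<in>q. l (snd z)) < \<delta>" using Um(2) by simp
      then have "(\<Sum>k\<in>snd ` q. l k) < \<delta>" by (subst reindex) (auto simp: l_def)
      moreover have "\<Union>(snd ` q) \<subseteq> {a..b}"
      proof
        fix t assume "t \<in> \<Union>(snd ` q)"
        then obtain x K where "(x, K) \<in> q" "t \<in> K" by auto
        then show "t \<in> {a..b}" using tagged_partial_division_ofD(3)[OF q] by blast
      qed
      ultimately have "sum h (snd ` q) < e / 2"
        using \<delta>[OF partial_division_of_tagged_division[OF q]] unfolding h_def l_def by blast
      then have bad: "(\<Sum>z\<in>q. h (snd z)) < e / 2" by (subst (asm) reindex) (auto simp: h_def)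
      have "(\<Sum>z\<in>p. \<bar>measure lborel (snd z) * f (fst z) - (y (Sup (snd z)) - y (Inf (snd z)))\<bar>)
          \<le> (\<Sum>z\<in>p. (if fst z \<in> N then h (snd z) else 0) + \<epsilon> * measure lborel (snd z))"
      proof (rule sum_mono)
        fix z assume z: "z \<in> p"
        obtain x K where zK: "z = (x, K)" by force
        obtain u v where K: "K = {u..v}" "u \<le> v" "x \<in> {u..v}" "{u..v} \<subseteq> {a..b}" "{u..v} \<subseteq> \<gamma> x"
          using pK z zK by blast
        show "\<bar>measure lborel (snd z) * f (fst z) - (y (Sup (snd z)) - y (Inf (snd z)))\<bar>
           \<le> (if fst z \<in> N then h (snd z) else 0) + \<epsilon> * measure lborel (snd z)"
        proof (cases "x \<in> N")
          case True
          have "0 \<le> \<epsilon> * (v - u)" using K(2) \<epsilon>(1) by simp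
          with True K show ?thesis by (simp add: zK f_def h_def abs_minus_commute)
        next
          case False
          have sub: "{u..v} \<subseteq> ball x (d x)" using K(5) False by (simp add: \<gamma>_def)
          have "u \<in> ball x (d x)" "v \<in> ball x (d x)" using sub K(2) by auto
          then have uv: "\<bar>u - x\<bar> < d x" "\<bar>v - x\<bar> < d x" by (auto simp: dist_real_def abs_minus_commute)
          have xin: "x \<in> {a..b} - N" using K False by auto
          \<comment> \<open>Straddle estimate: the tag lies between \<open>u\<close> and
            \<open>v\<close>, so the two linearization errors at \<open>x\<close> add up to at most
            \<open>\<epsilon>\<close> times the length.\<close>
          have "\<bar>(v - u) * y' x - (y v - y u)\<bar> =
              \<bar>(y u - y x - y' x * (u - x)) - (y v - y x - y' x * (v - x))\<bar>"
            by (simp add: algebra_simps)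
          also have "\<dots> \<le> \<epsilon> * \<bar>u - x\<bar> + \<epsilon> * \<bar>v - x\<bar>"
            using d(2)[OF xin uv(1)] d(2)[OF xin uv(2)] by linarith
          also have "\<dots> = \<epsilon> * (v - u)" using K(3) by (simp add: algebra_simps)
          finally show ?thesis using K False by (simp add: zK f_def)
        qed
      qed
      also have "\<dots> = (\<Sum>z\<in>q. h (snd z)) + \<epsilon> * (\<Sum>z\<in>p. measure lborel (snd z))"
        using \<open>finite p\<close> by (simp add: sum.distrib sum_distrib_left q_def sum.inter_filter)
      also have "(\<Sum>z\<in>p. measure lborel (snd z)) = b - a"
        using additive_content_tagged_division[of p a b] p \<open>a \<le> b\<close> by (simp add: case_prod_unfold)
      finally have *: "(\<Sum>z\<in>p. \<bar>measure lborel (snd z) * f (fst z) - (y (Sup (snd z)) - y (Inf (snd z)))\<bar>) < e"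
        using bad \<epsilon>(2) by linarith
      \<comment> \<open>The increments of \<open>y\<close> over a tagged division telescope to
        \<open>y b - y a\<close>, which allows a term-by-term comparison.\<close>
      have eq: "sum (\<lambda>(x,k). measure lborel k *\<^sub>R f x) p - (y b - y a) =
          (\<Sum>z\<in>p. measure lborel (snd z) * f (fst z) - (y (Sup (snd z)) - y (Inf (snd z))))"
        unfolding additive_tagged_division_1[OF \<open>a \<le> b\<close> p, of y, symmetric]
        by (simp add: case_prod_unfold sum_subtractf)
      show ?thesis
        unfolding eq real_norm_def by (rule le_less_trans[OF sum_abs *])
    qed
    show "\<exists>\<gamma>. gauge \<gamma> \<and> (\<forall>\<D>. \<D> tagged_division_of {a..b} \<and> \<gamma> fine \<D> \<longrightarrow>
        norm (sum (\<lambda>(x,k). measure lborel k *\<^sub>R f x) \<D> - (y b - y a)) < e)"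
      using gauge close by (intro exI[of _ \<gamma>] conjI allI impI) (auto simp only:)
  qed
  then show ?thesis
    by (rule has_integral_spike[OF N, rotated]) (auto simp: f_def)
qed

lemma abs_continuous_on_subset: "abs_continuous_on I y \<Longrightarrow> J \<subseteq> I \<Longrightarrow> abs_continuous_on J y"
  unfolding abs_continuous_on_def by (meson subset_trans)

lemma lipschitz_imp_abs_continuous_on:
  assumes y: "C-lipschitz_on I y"
  shows "abs_continuous_on I y"
  unfolding abs_continuous_on_def
proof (intro allI impI)
  fix \<epsilon> :: real assume "\<epsilon> > 0"
  have "C \<ge> 0" using y by (rule lipschitz_on_nonneg)
  show "\<exists>\<delta>>0. \<forall>d S. d division_of S \<and> S \<subseteq> I \<and> (\<Sum>k\<in>d. Sup k - Inf k) < \<delta> \<longrightarrow>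
        (\<Sum>k\<in>d. \<bar>y (Sup k) - y (Inf k)\<bar>) < \<epsilon>"
  proof (intro exI[of _ "\<epsilon> / (C + 1)"] conjI allI impI)
    show "\<epsilon> / (C + 1) > 0" using \<open>\<epsilon> > 0\<close> \<open>C \<ge> 0\<close> by simp
    fix d S assume d: "d division_of S \<and> S \<subseteq> I \<and> (\<Sum>k\<in>d. Sup k - Inf k) < \<epsilon> / (C + 1)"
    have "(\<Sum>k\<in>d. \<bar>y (Sup k) - y (Inf k)\<bar>) \<le> (\<Sum>k\<in>d. (C + 1) * (Sup k - Inf k))"
    proof (rule sum_mono)
      fix k assume "k \<in> d"
      then obtain u v where k: "k = {u..v}" "u \<le> v" "{u..v} \<subseteq> I" using d
        by (metis (no_types, lifting) atLeastatMost_empty_iff2 box_real(2) division_ofD(2,3,4) order_trans)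
      then have "\<bar>y v - y u\<bar> \<le> C * (v - u)"
        using lipschitz_onD[OF y, of v u] by (auto simp: dist_real_def subset_eq)
      also have "\<dots> \<le> (C + 1) * (v - u)" using k by (intro mult_right_mono) auto
      finally show "\<bar>y (Sup k) - y (Inf k)\<bar> \<le> (C + 1) * (Sup k - Inf k)" using k by simp
    qed
    also have "\<dots> = (C + 1) * (\<Sum>k\<in>d. Sup k - Inf k)" by (simp only: sum_distrib_left)
    also have "\<dots> < \<epsilon>"
      using d \<open>C \<ge> 0\<close> by (simp add: pos_less_divide_eq mult.commute)
    finally show "(\<Sum>k\<in>d. \<bar>y (Sup k) - y (Inf k)\<bar>) < \<epsilon>" .
  qed
qed

section \<open>The fundamental theorem of calculus in \<open>W11\<close> and the inclusion of
  \<open>Lip\<close>\<close>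

lemma AE_lebesgue_on_iff_negligible:
  assumes "S \<in> sets lebesgue"
  shows "(AE x in lebesgue_on S. P x) \<longleftrightarrow> negligible {x \<in> S. \<not> P x}"
proof -
  have "(AE x in lebesgue_on S. P x) \<longleftrightarrow> (AE x in lebesgue. x \<in> S \<longrightarrow> P x)"
    using assms by (simp add: AE_restrict_space_iff)
  also have "\<dots> \<longleftrightarrow> {x. \<not> (x \<in> S \<longrightarrow> P x)} \<in> null_sets lebesgue"
    using completion.AE_iff_null_sets[of "\<lambda>x. x \<in> S \<longrightarrow> P x"] by simp
  also have "{x. \<not> (x \<in> S \<longrightarrow> P x)} = {x \<in> S. \<not> P x}" by auto
  finally show ?thesis by (simp add: negligible_iff_null_sets)
qed

lemma W11_derivative_has_integral:
  assumes "y \<in> W11 {a..b}" and uv: "a \<le> u" "u \<le> v" "v \<le> b"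
  shows "(deriv y has_integral (y v - y u)) {u..v}"
proof (rule has_integral_derivative_abs_continuous)
  show "abs_continuous_on {u..v} y"
    by (rule abs_continuous_on_subset[of "{a..b}"]) (use assms in \<open>auto simp: W11_def\<close>)
  show "negligible {x \<in> {a..b}. \<not> y differentiable (at x)}"
    using assms by (subst AE_lebesgue_on_iff_negligible[symmetric]) (auto simp: W11_def)
  show "(y has_real_derivative deriv y x) (at x)" if "x \<in> {u..v} - {x \<in> {a..b}. \<not> y differentiable (at x)}" for x
    using that uv by (auto simp: DERIV_deriv_iff_real_differentiable)
qed fact

text \<open>By the fundamental theorem \<open>y\<close> is an indefinite integral of
  \<open>deriv y\<close>, and indefinite integrals are continuous.\<close>

lemma W11_continuous_on:
  assumes "y \<in> W11 {a..b}"
  shows "continuous_on {a..b} y"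
proof (cases "a \<le> b")
  case True
  have "deriv y integrable_on {a..b}"
    using W11_derivative_has_integral[OF assms, of a b] True by auto
  then have "continuous_on {a..b} (\<lambda>t. y a + integral {a..t} (deriv y))"
    by (intro continuous_intros indefinite_integral_continuous_1)
  moreover have "y a + integral {a..t} (deriv y) = y t" if "t \<in> {a..b}" for t
    using W11_derivative_has_integral[OF assms, of a t] that by (auto simp: integral_unique)
  ultimately show ?thesis
    using continuous_on_cong[of "{a..b}" "{a..b}" "\<lambda>t. y a + integral {a..t} (deriv y)" y] by simp
qed auto

text \<open>A Lipschitz function is the indefinite integral of some \<open>u\<close>, and such an
  integral has derivative \<open>u\<close> almost everywhere. Hence \<open>deriv y\<close> agrees
  with \<open>u\<close> up to a null set and inherits its integrability.\<close>

lemma Lip_subset_W11: "Lip {a..b} \<subseteq> W11 {a..b}"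
proof (cases "a \<le> b")
  case False
  then show ?thesis
    by (auto simp: Lip_def W11_def intro: lipschitz_imp_abs_continuous_on)
next
  case True
  show ?thesis
  proof
    fix y assume "y \<in> Lip {a..b}"
    then obtain C where C: "C-lipschitz_on {a..b} y" by (auto simp: Lip_def)
    \<comment> \<open>Clamping the argument extends \<open>y\<close> to the whole line with the same
      Lipschitz constant.\<close>
    define f where "f x = y (max a (min b x))" for x
    have "C-lipschitz_on UNIV f"
    proof (rule lipschitz_onI)
      fix x z :: real
      have "dist (f x) (f z) \<le> C * dist (max a (min b x)) (max a (min b z))"
        unfolding f_def using True by (intro lipschitz_onD[OF C]) auto
      also have "\<dots> \<le> C * dist x z"
        using lipschitz_on_nonneg[OF C] by (intro mult_left_mono) (auto simp: dist_real_def)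
      finally show "dist (f x) (f z) \<le> C * dist x z" .
    qed (rule lipschitz_on_nonneg[OF C])
    then obtain u where u: "\<And>a b. a \<le> b \<Longrightarrow> u absolutely_integrable_on {a..b}"
      "\<And>a b. a \<le> b \<Longrightarrow> (u has_integral (f b - f a)) {a..b}"
      using lipschitz_indefinite_integral by blast
    \<comment> \<open>The endpoints join the exceptional set: \<open>y\<close> is arbitrary outside
      \<open>{a..b}\<close>, so nothing is known about two-sided derivatives there.\<close>
    define N where "N = {x \<in> {a<..<b}. \<not> ((\<lambda>v. integral {a..v} u) has_real_derivative u x) (at x)} \<union> {a, b}"
    have "negligible N"
      unfolding N_def using u(2)[OF True] negligible_not_derivative_integral[of u a b] by auto
    have der: "(y has_real_derivative u x) (at x)" if "x \<in> {a..b} - N" for x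
    proof -
      have x: "x \<in> {a<..<b}" "((\<lambda>v. integral {a..v} u) has_real_derivative u x) (at x)"
        using that by (auto simp: N_def)
      have "((\<lambda>v. f a + integral {a..v} u) has_real_derivative 0 + u x) (at x)"
        by (intro derivative_intros x)
      then have "((\<lambda>v. f a + integral {a..v} u) has_real_derivative u x) (at x)" by simp
      moreover have "f a + integral {a..v} u = y v" if "v \<in> {a<..<b}" for v
        using u(2)[of a v] that by (auto simp: integral_unique f_def)
      ultimately show ?thesis
        by (rule has_field_derivative_transform_within_open[OF _ open_greaterThanLessThan x(1)])
    qed
    have "deriv y absolutely_integrable_on {a..b}"
    proof (rule absolutely_integrable_spike[OF u(1)[OF True] \<open>negligible N\<close>])
      show "deriv y x = u x" if "x \<in> {a..b} - N" for x
        using der[OF that] by (rule DERIV_imp_deriv)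
    qed
    then have "integrable (lebesgue_on {a..b}) (deriv y)"
      by (rule absolutely_integrable_imp_integrable) simp
    moreover have "AE t in lebesgue_on {a..b}. y differentiable (at t)"
    proof (subst AE_lebesgue_on_iff_negligible)
      show "negligible {x \<in> {a..b}. \<not> y differentiable (at x)}"
        by (rule negligible_subset[OF \<open>negligible N\<close>]) (use der in \<open>auto simp: real_differentiable_def\<close>)
    qed simp
    ultimately show "y \<in> W11 {a..b}"
      using lipschitz_imp_abs_continuous_on[OF C] by (simp add: W11_def)
  qed
qed

section \<open>Borel representatives of the derivative\<close>

lemma action_eq_nn_integral_lborel:
  assumes "AE t in lborel. t \<in> {0..1} \<longrightarrow> deriv y t = w t"
  shows "action L y = (\<integral>\<^sup>+t. L (y t, w t) * indicator {0..1} t \<partial>lborel)"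
proof -
  have "action L y = (\<integral>\<^sup>+t. L (y t, deriv y t) * indicator {0..1} t \<partial>lebesgue)"
    unfolding action_def by (subst nn_integral_restrict_space) auto
  also have "\<dots> = (\<integral>\<^sup>+t. L (y t, deriv y t) * indicator {0..1} t \<partial>lborel)"
    by (rule nn_integral_completion)
  also have "\<dots> = (\<integral>\<^sup>+t. L (y t, w t) * indicator {0..1} t \<partial>lborel)"
    by (rule nn_integral_cong_AE) (use assms in \<open>auto elim!: eventually_mono split: split_indicator\<close>)
  finally show ?thesis .
qed

text \<open>\<open>deriv y\<close> is only Lebesgue measurable. A Borel version \<open>w\<close>
  keeps compositions with the Borel function \<open>L\<close> and with a change of time measurable;
  its vanishing off the open interval later confines the change of speed to that interval.\<close>

lemma W11_borel_derivative:
  assumes y: "y \<in> W11 {a..b}"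
  obtains w where "w \<in> borel_measurable borel" "integrable lborel w" "\<And>t. t \<notin> {a<..<b} \<Longrightarrow> w t = 0"
    "AE t in lborel. t \<in> {a..b} \<longrightarrow> (y has_real_derivative w t) (at t)"
    "\<And>u v. a \<le> u \<Longrightarrow> u \<le> v \<Longrightarrow> v \<le> b \<Longrightarrow> (w has_integral (y v - y u)) {u..v}"
proof -
  define f where "f t = (if t \<in> {a..b} then deriv y t else 0)" for t
  have f: "integrable lebesgue f"
    using y Lebesgue_Measure.integrable_restrict_UNIV[of "{a..b}" "deriv y"] by (simp add: W11_def f_def[abs_def])
  obtain w0 where w0: "w0 \<in> borel_measurable lborel" "AE t in lborel. f t = w0 t"
    using completion_ex_borel_measurable_real[OF borel_measurable_integrable[OF f]] by auto
  define w where "w t = w0 t * indicator {a<..<b} t" for t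
  have [measurable]: "w \<in> borel_measurable borel" using w0(1) unfolding w_def by simp
  have "AE t in lborel. t \<noteq> a" "AE t in lborel. t \<noteq> b" by (rule AE_lborel_singleton)+
  with w0(2) have fw: "AE t in lborel. f t = w t"
    by eventually_elim (auto simp: f_def w_def split: split_indicator)
  have "integrable lebesgue w"
    using f fw by (subst integrable_cong_AE[of _ _ f]) (auto simp: measurable_completion AE_completion_iff eq_commute)
  then have w_int: "integrable lborel w" by (simp add: integrable_completion)
  have "AE t in lebesgue_on {a..b}. y differentiable (at t)" using y by (simp add: W11_def)
  then have "AE t in lborel. t \<in> {a..b} \<longrightarrow> y differentiable (at t)"
    by (simp add: AE_restrict_space_iff AE_completion_iff)
  with fw have ae: "AE t in lborel. t \<in> {a..b} \<longrightarrow> (y has_real_derivative w t) (at t)"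
    by eventually_elim (auto simp: f_def DERIV_deriv_iff_real_differentiable[symmetric])
  have "negligible {t. f t \<noteq> w t}"
    using fw completion.AE_iff_null_sets[of "\<lambda>t. f t = w t"]
    by (simp add: AE_completion_iff negligible_iff_null_sets)
  then have hi: "(w has_integral (y v - y u)) {u..v}" if "a \<le> u" "u \<le> v" "v \<le> b" for u v
    by (rule has_integral_spike[OF _ _ W11_derivative_has_integral[OF y that]]) (use that in \<open>auto simp: f_def\<close>)
  show thesis
    by (rule that[OF _ w_int _ ae hi]) (simp_all add: w_def)
qed

subsection \<open>Change of time\<close>

text \<open>Lebesgue measure is determined by the lengths of open intervals. The preimage of
  \<open>{l<..<u}\<close> under \<open>s\<close> is \<open>{\<tau> l<..<\<tau> u}\<close>, whose
  mass with density \<open>g\<close> is the increment of \<open>s\<close>, that is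
  \<open>u - l\<close>.\<close>

lemma distr_density_eq_lborel:
  fixes s \<tau> :: "real \<Rightarrow> real" and g :: "real \<Rightarrow> ennreal"
  assumes [measurable]: "g \<in> borel_measurable borel" "s \<in> borel_measurable borel"
    and g: "\<And>u v. u \<le> v \<Longrightarrow> (\<integral>\<^sup>+t. g t * indicator {u<..<v} t \<partial>lborel) = ennreal (s v - s u)"
    and s: "strict_mono s" and inv: "\<And>x. s (\<tau> x) = x"
  shows "distr (density lborel g) borel s = lborel"
proof (rule lborel_eqI[symmetric])
  fix l u :: real assume "\<And>b. b \<in> Basis \<Longrightarrow> l \<bullet> b \<le> u \<bullet> b"
  then have "l \<le> u" by simp
  have less: "s t < x \<longleftrightarrow> t < \<tau> x" "x < s t \<longleftrightarrow> \<tau> x < t" for t x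
    using strict_mono_less[OF s] inv by metis+
  have vim: "s -` {l<..<u} = {\<tau> l<..<\<tau> u}" by (auto simp: less)
  have "\<tau> l \<le> \<tau> u" using \<open>l \<le> u\<close> strict_mono_less_eq[OF s] inv by metis
  have "emeasure (distr (density lborel g) borel s) (box l u) = (\<integral>\<^sup>+t. g t * indicator {\<tau> l<..<\<tau> u} t \<partial>lborel)"
    by (subst emeasure_distr) (auto simp: vim emeasure_density)
  also have "\<dots> = ennreal (u - l)" using g[OF \<open>\<tau> l \<le> \<tau> u\<close>] inv by simp
  finally show "emeasure (distr (density lborel g) borel s) (box l u) = (\<Prod>b\<in>Basis. (u - l) \<bullet> b)"
    by simp
qed simp

text \<open>The new time is \<open>t\<close> plus the integral of the excess \<open>g - 1\<close>,
  which is integrable and supported in the unit interval. Slopes are at least \<open>1\<close>, so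
  \<open>s\<close> is a homeomorphism of the line with a 1-Lipschitz inverse; on the whole line the
  push-forward is exactly \<open>lborel\<close>.\<close>

lemma time_change:
  fixes g :: "real \<Rightarrow> real"
  assumes [measurable]: "g \<in> borel_measurable borel" and g1: "\<And>t. 1 \<le> g t"
    and off: "\<And>t. t \<notin> {0<..<1} \<Longrightarrow> g t = 1"
    and int: "integrable lborel (\<lambda>t. g t - 1)"
  obtains s \<tau> where "strict_mono s" "s 0 = 0" "\<And>x. s (\<tau> x) = x" "\<And>t. \<tau> (s t) = t"
    "\<And>u v. u \<le> v \<Longrightarrow> v - u \<le> s v - s u"
    "\<And>u v. u \<le> v \<Longrightarrow> (g has_integral (s v - s u)) {u..v}"
    "continuous_on UNIV s" "continuous_on UNIV \<tau>"
    "AE t in lborel. t \<in> {0..1} \<longrightarrow> (s has_real_derivative g t) (at t)"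
    "distr (density lborel (\<lambda>t. ennreal (g t))) borel s = lborel"
proof -
  define k where "k t = g t - 1" for t
  have k0: "k t = 0" if "t \<notin> {0<..<1}" for t using off[OF that] by (simp add: k_def)
  define s where "s t = t + integral {0..t} k" for t
  have kint: "k integrable_on {u..v}" for u v
  proof -
    have "k integrable_on UNIV"
      using integrable_on_lborel[OF int] unfolding k_def[abs_def] .
    then show ?thesis by (rule integrable_on_subinterval) auto
  qed
  \<comment> \<open>For negative endpoints the interval from \<open>0\<close> is empty and its
    integral is \<open>0\<close>. This is the right value because \<open>k\<close> vanishes
    there.\<close>
  have kdiff: "integral {0..v} k - integral {0..u} k = integral {u..v} k" if "u \<le> v" for u v
  proof (cases "0 \<le> u")
    case True
    then show ?thesis
      using Henstock_Kurzweil_Integration.integral_combine[OF True that kint] by simp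
  next
    case False
    have zero: "integral {u..w} k = 0" if "w \<le> 0" for w
    proof -
      have "integral {u..w} k = integral {u..w} (\<lambda>_. 0)"
        by (rule integral_cong) (use that in \<open>auto intro!: k0\<close>)
      then show ?thesis by simp
    qed
    show ?thesis
    proof (cases "0 \<le> v")
      case True
      then show ?thesis
        using Henstock_Kurzweil_Integration.integral_combine[of u 0 v k] kint False zero[of 0] by simp
    next
      case vneg: False
      then show ?thesis using zero[of v] False by simp
    qed
  qed
  have has: "(g has_integral (s v - s u)) {u..v}" if "u \<le> v" for u v
  proof -
    have "((\<lambda>t. k t + 1) has_integral (integral {u..v} k + (v - u) *\<^sub>R 1)) {u..v}"
      using kint that has_integral_const_real[of "1::real" u v] by (intro has_integral_add) (auto simp: integrable_integral)
    then show ?thesis using kdiff[OF that] by (simp add: k_def s_def algebra_simps)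
  qed
  have slope: "v - u \<le> s v - s u" if "u \<le> v" for u v
    using kdiff[OF that] integral_nonneg[OF kint, of u v] g1 by (auto simp: s_def k_def)
  have sm: "strict_mono s"
  proof (rule strict_monoI)
    show "s u < s v" if "u < v" for u v using slope[of u v] that by simp
  qed
  have s0: "s 0 = 0" by (simp add: s_def)
  have conts: "continuous_on UNIV s"
  proof (rule continuous_at_imp_continuous_on, intro ballI)
    fix x :: real
    have "continuous_on {x-1..x+1} (\<lambda>t. t + (integral {0..x-1} k + integral {x-1..t} k))"
      by (intro continuous_intros indefinite_integral_continuous_1 kint)
    moreover have "t + (integral {0..x-1} k + integral {x-1..t} k) = s t" if "t \<in> {x-1..x+1}" for t
      using kdiff[of "x-1" t] that by (simp add: s_def)
    ultimately have "continuous_on {x-1..x+1} s"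
      using continuous_on_cong[of "{x-1..x+1}" "{x-1..x+1}" "\<lambda>t. t + (integral {0..x-1} k + integral {x-1..t} k)" s] by simp
    then have "continuous_on {x-1<..<x+1} s" by (rule continuous_on_subset) auto
    then show "isCont s x" by (simp add: continuous_on_eq_continuous_at)
  qed
  have "surj s"
    unfolding surj_def
  proof
    fix z
    have "\<bar>z\<bar> - 0 \<le> s \<bar>z\<bar> - s 0" by (rule slope) simp
    then have 1: "z \<le> s \<bar>z\<bar>" using s0 by simp
    have "0 - (- \<bar>z\<bar>) \<le> s 0 - s (- \<bar>z\<bar>)" by (rule slope) simp
    then have 2: "s (- \<bar>z\<bar>) \<le> z" using s0 by simp
    show "\<exists>x. z = s x"
      using IVT'[OF 2 1 _ continuous_on_subset[OF conts]] by auto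
  qed
  define \<tau> where "\<tau> = inv s"
  have st: "s (\<tau> x) = x" for x using \<open>surj s\<close> by (simp add: \<tau>_def surj_f_inv_f)
  have ts: "\<tau> (s t) = t" for t using strict_mono_imp_inj_on[OF sm] by (simp add: \<tau>_def inv_f_f)
  have "\<bar>\<tau> x - \<tau> z\<bar> \<le> \<bar>x - z\<bar>" for x z
    using slope[of "\<tau> x" "\<tau> z"] slope[of "\<tau> z" "\<tau> x"] st by (cases "\<tau> x \<le> \<tau> z") auto
  then have "1-lipschitz_on UNIV \<tau>" by (intro lipschitz_onI) (auto simp: dist_real_def)
  then have cont\<tau>: "continuous_on UNIV \<tau>" by (rule lipschitz_on_continuous_on)
  have ae: "AE t in lborel. t \<in> {0..1} \<longrightarrow> (s has_real_derivative g t) (at t)"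
  proof -
    have "negligible ({t \<in> {0<..<1}. \<not> ((\<lambda>u. integral {0..u} k) has_real_derivative k t) (at t)} \<union> {0, 1})"
      using negligible_not_derivative_integral[OF kint] by auto
    then have "negligible {t. \<not> (t \<in> {0..1} \<longrightarrow> (s has_real_derivative g t) (at t))}"
    proof (rule negligible_subset)
      have "(s has_real_derivative g t) (at t)" if "((\<lambda>u. integral {0..u} k) has_real_derivative k t) (at t)" for t
      proof -
        have "((\<lambda>u. u + integral {0..u} k) has_real_derivative 1 + k t) (at t)"
          by (intro derivative_intros that)
        then show ?thesis by (simp add: s_def[abs_def] k_def)
      qed
      then show "{t. \<not> (t \<in> {0..1} \<longrightarrow> (s has_real_derivative g t) (at t))}
          \<subseteq> {t \<in> {0<..<1}. \<not> ((\<lambda>u. integral {0..u} k) has_real_derivative k t) (at t)} \<union> {0, 1}"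
        by force
    qed
    then show ?thesis
      using completion.AE_iff_null_sets[of "\<lambda>t. t \<in> {0..1} \<longrightarrow> (s has_real_derivative g t) (at t)" lborel]
      by (simp add: negligible_iff_null_sets AE_completion_iff)
  qed
  have dens: "distr (density lborel (\<lambda>t. ennreal (g t))) borel s = lborel"
  proof (rule distr_density_eq_lborel[where \<tau> = \<tau>])
    show "s \<in> borel_measurable borel" using conts by (rule borel_measurable_continuous_onI)
    fix u v :: real assume "u \<le> v"
    have "(g has_integral (s v - s u)) {u<..<v}"
      using has[OF \<open>u \<le> v\<close>] by (simp add: has_integral_Icc_iff_Ioo)
    then have "integral\<^sup>N lborel (\<lambda>x. indicator {u<..<v} x * g x) = ennreal (s v - s u)"
      by (intro nn_integral_has_integral_lebesgue) (use g1 order_trans[OF zero_le_one] in auto)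
    moreover have "integral\<^sup>N lborel (\<lambda>x. indicator {u<..<v} x * g x) = (\<integral>\<^sup>+t. ennreal (g t) * indicator {u<..<v} t \<partial>lborel)"
      by (intro nn_integral_cong) (auto split: split_indicator)
    ultimately show "(\<integral>\<^sup>+t. ennreal (g t) * indicator {u<..<v} t \<partial>lborel) = ennreal (s v - s u)" by simp
  qed (use sm st in auto)
  show thesis by (rule that[OF sm s0 st ts slope has conts cont\<tau> ae dens])
qed

text \<open>A Lebesgue null set \<open>N\<close> has mass zero for the density \<open>g\<close>, and
  the push-forward of that mass under \<open>s\<close> is Lebesgue measure; so the points that
  \<open>\<tau>\<close> sends into \<open>N\<close> form a null set.\<close>

lemma AE_lborel_time_change:
  fixes s \<tau> :: "real \<Rightarrow> real" and g :: "real \<Rightarrow> ennreal"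
  assumes [measurable]: "g \<in> borel_measurable borel" "s \<in> borel_measurable borel" "\<tau> \<in> borel_measurable borel"
    and lb: "distr (density lborel g) borel s = lborel"
    and ts: "\<And>t. \<tau> (s t) = t" and P: "AE t in lborel. P t"
  shows "AE x in lborel. P (\<tau> x)"
proof -
  obtain N where N: "N \<in> null_sets lborel" "{t. \<not> P t} \<subseteq> N"
    using P by (auto elim!: AE_E simp: null_sets_def)
  then have [measurable]: "N \<in> sets borel" by auto
  have "AE t in lborel. t \<notin> N" using N(1) by (rule AE_not_in)
  then have "AE t in lborel. g t \<noteq> 0 \<longrightarrow> \<tau> (s t) \<notin> N" by eventually_elim (simp add: ts)
  then have "AE t in density lborel g. \<tau> (s t) \<notin> N" by (simp add: AE_density zero_less_iff_neq_zero)
  then have "AE x in distr (density lborel g) borel s. \<tau> x \<notin> N" by (subst AE_distr_iff) auto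
  then have "AE x in lborel. \<tau> x \<notin> N" unfolding lb .
  then show ?thesis by eventually_elim (use N(2) in auto)
qed

text \<open>The curve is \<open>y\<close> composed with the inverse time \<open>\<tau>\<close>. By
  the chain rule its velocity at time \<open>s t\<close> is \<open>w t / g t\<close>, bounded by
  \<open>K\<close>, and substituting \<open>s t\<close> in the action produces the factor
  \<open>g t\<close>.\<close>

lemma lipschitz_reparametrization:
  fixes y w g :: "real \<Rightarrow> real" and L :: "real \<times> real \<Rightarrow> ennreal"
  assumes L[measurable]: "L \<in> borel_measurable borel"
    and y: "continuous_on {0..1} y"
    and w[measurable]: "w \<in> borel_measurable borel"
    and w_der: "AE t in lborel. t \<in> {0..1} \<longrightarrow> (y has_real_derivative w t) (at t)"
    and w_int: "\<And>u v. 0 \<le> u \<Longrightarrow> u \<le> v \<Longrightarrow> v \<le> 1 \<Longrightarrow> (w has_integral (y v - y u)) {u..v}"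
    and g[measurable]: "g \<in> borel_measurable borel" and g1: "\<And>t. 1 \<le> g t"
    and off: "\<And>t. t \<notin> {0<..<1} \<Longrightarrow> g t = 1"
    and g_int: "integrable lborel (\<lambda>t. g t - 1)"
    and bound: "\<And>t. t \<in> {0..1} \<Longrightarrow> \<bar>w t\<bar> \<le> K * g t"
  obtains z where "z \<in> Lip {0..1}" "z 0 = y 0"
    "action L z \<le> (\<integral>\<^sup>+t. ennreal (g t) * L (y t, w t / g t) * indicator {0..1} t \<partial>lborel)"
proof (rule time_change[OF g g1 off g_int])
  fix s \<tau>
  assume sm: "strict_mono s" and s0: "s 0 = 0" and st: "\<And>x. s (\<tau> x) = x" and ts: "\<And>t. \<tau> (s t) = t"
    and slope: "\<And>u v. u \<le> v \<Longrightarrow> v - u \<le> s v - s u"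
    and s_int: "\<And>u v. u \<le> v \<Longrightarrow> (g has_integral (s v - s u)) {u..v}"
    and conts: "continuous_on UNIV s" and cont\<tau>: "continuous_on UNIV \<tau>"
    and s_der: "AE t in lborel. t \<in> {0..1} \<longrightarrow> (s has_real_derivative g t) (at t)"
    and lb: "distr (density lborel (\<lambda>t. ennreal (g t))) borel s = lborel"
  have [measurable]: "s \<in> borel_measurable borel" "\<tau> \<in> borel_measurable borel"
    using conts cont\<tau> by (auto intro: borel_measurable_continuous_onI)
  have \<tau>0: "\<tau> 0 = 0" using ts[of 0] s0 by simp
  have \<tau>_mono: "\<tau> u \<le> \<tau> v" if "u \<le> v" for u v
    using strict_mono_less_eq[OF sm, of "\<tau> u" "\<tau> v"] st that by simp
  \<comment> \<open>The new curve runs late: at time \<open>x\<close> it has reached only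
    \<open>y\<close> at \<open>\<tau> x\<close>, so times up to \<open>1\<close> use only values of
    \<open>y\<close> on \<open>{0..1}\<close>.\<close>
  have \<tau>_le: "\<tau> x \<le> x" if "0 \<le> x" for x
    using slope[of 0 "\<tau> x"] \<tau>_mono[OF that] \<tau>0 s0 st by simp
  have \<tau>_Icc: "\<tau> x \<in> {0..1}" if "x \<in> {0..1}" for x
    using \<tau>_mono[of 0 x] \<tau>_le[of x] \<tau>0 that by auto
  define yc where "yc t = y (max 0 (min 1 t))" for t
  have yc: "yc t = y t" if "t \<in> {0..1}" for t using that by (simp add: yc_def)
  have "continuous_on UNIV yc"
    unfolding yc_def by (rule continuous_on_compose2[OF y]) (auto intro!: continuous_intros)
  then have [measurable]: "yc \<in> borel_measurable borel" by (rule borel_measurable_continuous_onI)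
  define z where "z x = yc (\<tau> x)" for x
  define v where "v x = w (\<tau> x) / g (\<tau> x)" for x
  have [measurable]: "z \<in> borel_measurable borel" "v \<in> borel_measurable borel"
    unfolding z_def[abs_def] v_def[abs_def] by measurable
  have z0: "z 0 = y 0" by (simp add: z_def \<tau>0 yc)
  have "0 \<le> K"
  proof -
    have "0 \<le> K * g 0" using bound[of 0] by (meson abs_ge_zero atLeastAtMost_iff order_trans zero_le_one order_refl)
    then show ?thesis using g1[of 0] by (simp add: zero_le_mult_iff)
  qed
  \<comment> \<open>The bound of \<open>w\<close> by \<open>K * g\<close> is integrated from
    \<open>\<tau> a\<close> to \<open>\<tau> b\<close>, where \<open>g\<close> has integral
    \<open>s (\<tau> b) - s (\<tau> a) = b - a\<close>.\<close>
  have lip: "\<bar>z b - z a\<bar> \<le> K * (b - a)" if ab: "a \<in> {0..1}" "b \<in> {0..1}" "a \<le> b" for a b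
  proof -
    have t: "0 \<le> \<tau> a" "\<tau> a \<le> \<tau> b" "\<tau> b \<le> 1" using \<tau>_Icc ab \<tau>_mono by auto
    have "((\<lambda>t. K * g t) has_integral (K * (b - a))) {\<tau> a..\<tau> b}"
      using has_integral_mult_right[OF s_int[OF t(2)], of K] by (simp add: st)
    then have "norm (y (\<tau> b) - y (\<tau> a)) \<le> K * (b - a)"
      using has_integral_norm_bound_integral_component[OF w_int[OF t], of "\<lambda>t. K * g t" "K * (b - a)" 1] bound t
      by auto
    then show ?thesis using \<tau>_Icc ab by (simp add: z_def yc)
  qed
  have "K-lipschitz_on {0..1} z"
  proof (rule lipschitz_onI)
    fix a b :: real assume ab: "a \<in> {0..1}" "b \<in> {0..1}"
    show "dist (z a) (z b) \<le> K * dist a b"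
      using lip[OF ab] lip[OF ab(2,1)] by (cases "a \<le> b") (auto simp: dist_real_def abs_minus_commute)
  qed fact
  then have z_Lip: "z \<in> Lip {0..1}" by (auto simp: Lip_def)
  \<comment> \<open>Good points are transported through \<open>\<tau>\<close>. The interval is open
    because \<open>yc\<close> agrees with \<open>y\<close> near its points, so the derivative passes
    to \<open>yc\<close>.\<close>
  have "AE t in lborel. t \<in> {0<..<1} \<longrightarrow> (y has_real_derivative w t) (at t) \<and> (s has_real_derivative g t) (at t)"
    using w_der s_der by eventually_elim auto
  then have "AE x in lborel. \<tau> x \<in> {0<..<1} \<longrightarrow>
      (y has_real_derivative w (\<tau> x)) (at (\<tau> x)) \<and> (s has_real_derivative g (\<tau> x)) (at (\<tau> x))"
    by (intro AE_lborel_time_change[OF _ _ _ lb ts, where P = "\<lambda>t. t \<in> {0<..<1} \<longrightarrow>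
      (y has_real_derivative w t) (at t) \<and> (s has_real_derivative g t) (at t)"]) auto
  moreover have "AE x in lborel. x \<noteq> (0::real)" "AE x in lborel. x \<noteq> (1::real)" by (rule AE_lborel_singleton)+
  ultimately have z_der: "AE x in lborel. x \<in> {0..1} \<longrightarrow> deriv z x = v x"
  proof eventually_elim
    case (elim x)
    show ?case
    proof
      assume "x \<in> {0..1}"
      then have x: "0 < x" "x < 1" using elim by auto
      then have \<tau>x: "0 < \<tau> x" "\<tau> x < 1"
        using \<tau>_le[of x] \<tau>_mono[of 0 x] \<tau>0 s0 st[of x] by (auto simp: less_le)
      then have d: "(y has_real_derivative w (\<tau> x)) (at (\<tau> x))" "(s has_real_derivative g (\<tau> x)) (at (\<tau> x))"
        using elim by auto
      have "(\<tau> has_real_derivative inverse (g (\<tau> x))) (at x)"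
        by (rule DERIV_inverse_function[where f = s and g = \<tau> and x = x, OF d(2) _ x])
          (use g1[of "\<tau> x"] st cont\<tau> in \<open>auto simp: continuous_on_eq_continuous_at\<close>)
      moreover have "(yc has_real_derivative w (\<tau> x)) (at (\<tau> x))"
        by (rule has_field_derivative_transform_within_open[OF d(1) open_greaterThanLessThan, of 0 1])
          (use \<tau>x in \<open>auto simp: yc\<close>)
      ultimately have "((\<lambda>x. yc (\<tau> x)) has_real_derivative w (\<tau> x) * inverse (g (\<tau> x))) (at x)"
        by (rule DERIV_chain2[rotated])
      then show "deriv z x = v x"
        by (intro DERIV_imp_deriv) (simp add: z_def[abs_def] v_def divide_inverse)
    qed
  qed
  have "action L z = (\<integral>\<^sup>+x. L (z x, v x) * indicator {0..1} x \<partial>lborel)"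
    by (rule action_eq_nn_integral_lborel[OF z_der])
  also have "\<dots> = (\<integral>\<^sup>+x. L (z x, v x) * indicator {0..1} x \<partial>distr (density lborel (\<lambda>t. ennreal (g t))) borel s)"
    unfolding lb ..
  also have "\<dots> = (\<integral>\<^sup>+t. ennreal (g t) * (L (z (s t), v (s t)) * indicator {0..1} (s t)) \<partial>lborel)"
    by (subst nn_integral_distr, measurable, subst nn_integral_density) auto
  \<comment> \<open>If \<open>s t\<close> lies in \<open>{0..1}\<close>, so does \<open>t\<close>.
    The inequality discards the part of the curve traversed after time \<open>1\<close>, whose
    contribution is nonnegative.\<close>
  also have "\<dots> \<le> (\<integral>\<^sup>+t. ennreal (g t) * L (y t, w t / g t) * indicator {0..1} t \<partial>lborel)"
  proof (rule nn_integral_mono)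
    fix t :: real
    show "ennreal (g t) * (L (z (s t), v (s t)) * indicator {0..1} (s t))
      \<le> ennreal (g t) * L (y t, w t / g t) * indicator {0..1} t"
      using \<tau>_Icc[of "s t"] yc[of t] by (auto simp: z_def v_def ts split: split_indicator)
  qed
  finally show thesis by (rule that[OF z_Lip z0])
qed

subsection \<open>Approximation in action\<close>

text \<open>Dominated convergence: at each point the indicator vanishes once \<open>n\<close>
  exceeds the value there, and the absolute value of \<open>f\<close> dominates.\<close>

lemma tendsto_nn_integral_tail:
  fixes f :: "'a \<Rightarrow> real"
  assumes f: "integrable M f"
  shows "(\<lambda>n. \<integral>\<^sup>+x. ennreal \<bar>f x\<bar> * indicator {x. real n < \<bar>f x\<bar>} x \<partial>M) \<longlonglongrightarrow> 0"
proof -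
  have [measurable]: "f \<in> borel_measurable M" using f by simp
  have "(\<lambda>n. \<integral>\<^sup>+x. ennreal \<bar>f x\<bar> * indicator {x. real n < \<bar>f x\<bar>} x \<partial>M) \<longlonglongrightarrow> (\<integral>\<^sup>+x. 0 \<partial>M)"
  proof (rule nn_integral_dominated_convergence[where w = "\<lambda>x. ennreal \<bar>f x\<bar>"])
    show "(\<integral>\<^sup>+x. ennreal \<bar>f x\<bar> \<partial>M) < \<infinity>" using f by (simp add: integrable_iff_bounded)
    have "(\<lambda>n. ennreal \<bar>f x\<bar> * indicator {x. real n < \<bar>f x\<bar>} x) \<longlonglongrightarrow> 0" for x
    proof (rule tendsto_eventually)
      obtain m where "\<bar>f x\<bar> \<le> real m" using real_arch_simple by blast
      then show "\<forall>\<^sub>F n in sequentially. ennreal \<bar>f x\<bar> * indicator {x. real n < \<bar>f x\<bar>} x = 0"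
        by (intro eventually_sequentiallyI[of m]) (auto split: split_indicator)
    qed
    then show "AE x in M. (\<lambda>n. ennreal \<bar>f x\<bar> * indicator {x. real n < \<bar>f x\<bar>} x) \<longlonglongrightarrow> 0" by simp
    show "\<And>j. AE x in M. ennreal \<bar>f x\<bar> * indicator {x. real j < \<bar>f x\<bar>} x \<le> ennreal \<bar>f x\<bar>"
      by (auto split: split_indicator)
  qed measurable
  then show ?thesis by simp
qed

lemma continuous_pos_bounds:
  fixes f :: "real \<Rightarrow> real"
  assumes f: "continuous_on {a..b} f" and pos: "\<And>z. f z > 0"
  obtains m K where "0 < m" "\<And>z. z \<in> {a..b} \<Longrightarrow> m \<le> f z" "\<And>z. z \<in> {a..b} \<Longrightarrow> f z \<le> K"
proof (cases "{a..b} = {}")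
  case True
  then show thesis using that[of 1 0] by auto
next
  case False
  obtain u where "u \<in> {a..b}" "\<And>z. z \<in> {a..b} \<Longrightarrow> f u \<le> f z"
    using continuous_attains_inf[OF compact_Icc False f] by blast
  moreover obtain v where "v \<in> {a..b}" "\<And>z. z \<in> {a..b} \<Longrightarrow> f z \<le> f v"
    using continuous_attains_sup[OF compact_Icc False f] by blast
  ultimately show thesis using that[of "f u" "f v"] pos by blast
qed

text \<open>For each large threshold \<open>n\<close> the reparametrized curve is a Lipschitz
  competitor with the same initial value, and its action exceeds that of \<open>y\<close> by at most
  \<open>B / m\<close> times the integral of the speed where it exceeds \<open>n\<close>.\<close>

lemma lipschitz_approximation:
  fixes L :: "real \<times> real \<Rightarrow> ennreal" and \<rho>m \<rho>p y :: "real \<Rightarrow> real"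
  assumes L: "L \<in> borel_measurable borel"
    and cont: "continuous_on UNIV \<rho>m" "continuous_on UNIV \<rho>p"
    and neg: "\<And>z. \<rho>m z < 0" and pos: "\<And>z. \<rho>p z > 0"
    and fin: "\<And>J. is_interval J \<Longrightarrow> bounded J \<Longrightarrow> (SUP z\<in>J. L (z, \<rho>m z)) < \<infinity>"
      "\<And>J. is_interval J \<Longrightarrow> bounded J \<Longrightarrow> (SUP z\<in>J. L (z, \<rho>p z)) < \<infinity>"
    and y: "y \<in> W11 {0..1}"
  shows "(INF z\<in>{z \<in> Lip {0..1}. z 0 = y 0}. action L z) \<le> action L y"
proof (rule W11_borel_derivative[OF y])
  fix w
  assume w[measurable]: "w \<in> borel_measurable borel" and w_integrable: "integrable lborel w"
    and w_off: "\<And>t. t \<notin> {0<..<1} \<Longrightarrow> w t = 0"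
    and w_der: "AE t in lborel. t \<in> {0..1} \<longrightarrow> (y has_real_derivative w t) (at t)"
    and w_int: "\<And>u v. 0 \<le> u \<Longrightarrow> u \<le> v \<Longrightarrow> v \<le> 1 \<Longrightarrow> (w has_integral (y v - y u)) {u..v}"
  have conty: "continuous_on {0..1} y" by (rule W11_continuous_on[OF y])
  obtain R where R: "\<And>t. t \<in> {0..1} \<Longrightarrow> y t \<in> {-R..R}"
  proof -
    have "bounded (y ` {0..1})" using conty by (intro compact_imp_bounded compact_continuous_image) auto
    then obtain r where "\<forall>x\<in>y ` {0..1}. norm x \<le> r" unfolding bounded_iff by blast
    then show ?thesis using that[of r] by (auto simp: abs_le_iff minus_le_iff)
  qed
  obtain mp Kp where p: "0 < mp" "\<And>z. z \<in> {-R..R} \<Longrightarrow> mp \<le> \<rho>p z" "\<And>z. z \<in> {-R..R} \<Longrightarrow> \<rho>p z \<le> Kp"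
    by (rule continuous_pos_bounds[OF continuous_on_subset[OF cont(2)] pos]) auto
  obtain mm Km where m: "0 < mm" "\<And>z. z \<in> {-R..R} \<Longrightarrow> mm \<le> - \<rho>m z" "\<And>z. z \<in> {-R..R} \<Longrightarrow> - \<rho>m z \<le> Km"
    using continuous_pos_bounds[of "-R" R "\<lambda>z. - \<rho>m z"] neg continuous_on_subset[OF continuous_on_minus[OF cont(1)], of "{-R..R}"]
    by (metis neg_0_less_iff_less subset_UNIV)
  \<comment> \<open>\<open>m\<close> and \<open>K\<close> bound the absolute value of both fields on
    the range of \<open>y\<close>: \<open>m\<close> gives \<open>g\<close> at most the speed over
    \<open>m\<close>, and \<open>K\<close> tells from which \<open>n\<close> on \<open>g\<close> is
    at least \<open>1\<close>.\<close>
  define m where "m = min mp mm"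
  define K where "K = max Kp Km"
  have m: "0 < m" and \<rho>p: "\<And>z. z \<in> {-R..R} \<Longrightarrow> m \<le> \<rho>p z \<and> \<rho>p z \<le> K"
    and \<rho>m: "\<And>z. z \<in> {-R..R} \<Longrightarrow> m \<le> - \<rho>m z \<and> - \<rho>m z \<le> K"
    using p m unfolding m_def K_def by fastforce+
  define B where "B = max (SUP z\<in>{-R..R}. L (z, \<rho>m z)) (SUP z\<in>{-R..R}. L (z, \<rho>p z))"
  have B_fin: "B < \<infinity>"
    using fin[of "{-R..R}"] by (simp add: B_def is_interval_cc)
  have B: "L (z, \<rho>m z) \<le> B" "L (z, \<rho>p z) \<le> B" if "z \<in> {-R..R}" for z
  proof -
    have "L (z, \<rho>m z) \<le> (SUP z\<in>{-R..R}. L (z, \<rho>m z))" using that by (rule SUP_upper)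
    also have "\<dots> \<le> B" by (simp add: B_def)
    finally show "L (z, \<rho>m z) \<le> B" .
    have "L (z, \<rho>p z) \<le> (SUP z\<in>{-R..R}. L (z, \<rho>p z))" using that by (rule SUP_upper)
    also have "\<dots> \<le> B" by (simp add: B_def)
    finally show "L (z, \<rho>p z) \<le> B" .
  qed
  define yc where "yc t = y (max 0 (min 1 t))" for t
  have yc: "yc t = y t" if "t \<in> {0..1}" for t using that by (simp add: yc_def)
  have "continuous_on UNIV yc"
    unfolding yc_def by (rule continuous_on_compose2[OF conty]) (auto intro!: continuous_intros)
  then have [measurable]: "yc \<in> borel_measurable borel" by (rule borel_measurable_continuous_onI)
  have [measurable]: "\<rho>m \<in> borel_measurable borel" "\<rho>p \<in> borel_measurable borel"
    using cont by (auto intro: borel_measurable_continuous_onI)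
  have ycR: "yc t \<in> {-R..R}" for t unfolding yc_def by (rule R) auto
  define tail where "tail n = (\<integral>\<^sup>+t. ennreal \<bar>w t\<bar> * indicator {t. real n < \<bar>w t\<bar>} t \<partial>lborel)" for n
  have bound: "(INF z\<in>{z \<in> Lip {0..1}. z 0 = y 0}. action L z) \<le> action L y + B * ennreal (1 / m) * tail n"
    if n: "K \<le> real n" for n
  proof -
    define A where "A = {t. t \<in> {0<..<1} \<and> real n < \<bar>w t\<bar>}"
    \<comment> \<open>The field is chosen by the sign of \<open>w\<close>, so the quotient defining
      \<open>g\<close> is positive on \<open>A\<close> and the direction of motion is kept.\<close>
    define \<rho> where "\<rho> t = (if 0 < w t then \<rho>p (yc t) else \<rho>m (yc t))" for t
    define g where "g t = (if t \<in> A then w t / \<rho> t else 1)" for t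
    have [measurable]: "A \<in> sets borel" unfolding A_def by measurable
    have [measurable]: "\<rho> \<in> borel_measurable borel" unfolding \<rho>_def by measurable
    have g_meas: "g \<in> borel_measurable borel" unfolding g_def by measurable
    have K0: "0 < K" using m \<rho>p[OF ycR[of 0]] by linarith
    have \<rho>_abs: "m \<le> \<bar>\<rho> t\<bar>" "\<bar>\<rho> t\<bar> \<le> K" for t
      using \<rho>p[OF ycR[of t]] \<rho>m[OF ycR[of t]] m by (auto simp: \<rho>_def)
    have g_A: "g t = \<bar>w t\<bar> / \<bar>\<rho> t\<bar>" "1 \<le> g t" "w t / g t = \<rho> t" if "t \<in> A" for t
    proof -
      have w0: "real n < \<bar>w t\<bar>" using that by (simp add: A_def)
      then have "w t \<noteq> 0" using n K0 by auto
      then show gt: "g t = \<bar>w t\<bar> / \<bar>\<rho> t\<bar>"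
        using that neg[of "yc t"] pos[of "yc t"] by (auto simp: g_def \<rho>_def abs_if)
      show "1 \<le> g t" unfolding gt using w0 n \<rho>_abs[of t] m by simp
      show "w t / g t = \<rho> t" using that \<open>w t \<noteq> 0\<close> by (simp add: g_def)
    qed
    have g1: "1 \<le> g t" for t using g_A(2)[of t] by (cases "t \<in> A") (auto simp: g_def)
    have off: "g t = 1" if "t \<notin> {0<..<1}" for t using that by (auto simp: g_def A_def)
    have g_le: "g t \<le> \<bar>w t\<bar> * (1 / m)" if "t \<in> A" for t
    proof -
      have "\<bar>w t\<bar> / \<bar>\<rho> t\<bar> \<le> \<bar>w t\<bar> / m" using \<rho>_abs(1)[of t] m by (intro divide_left_mono) auto
      then show ?thesis using g_A(1)[OF that] by simp
    qed
    have g_int: "integrable lborel (\<lambda>t. g t - 1)"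
    proof (rule Bochner_Integration.integrable_bound)
      show "integrable lborel (\<lambda>t. w t * (1 / m))" using w_integrable by (rule integrable_mult_left)
      show "(\<lambda>t. g t - 1) \<in> borel_measurable lborel" using g_meas by simp
      have "norm (g t - 1) \<le> norm (w t * (1 / m))" for t
        using g1[of t] g_le[of t] m by (cases "t \<in> A") (auto simp: g_def abs_mult)
      then show "AE t in lborel. norm (g t - 1) \<le> norm (w t * (1 / m))" by simp
    qed
    \<comment> \<open>The threshold itself serves as Lipschitz constant: on \<open>A\<close> the new
      speed is at most \<open>K\<close>, hence at most \<open>n\<close>; off \<open>A\<close> the
      speed is unchanged and at most \<open>n\<close>.\<close>
    have w_le: "\<bar>w t\<bar> \<le> real n * g t" for t
    proof (cases "t \<in> A")
      case True
      have "\<bar>w t\<bar> = \<bar>\<rho> t\<bar> * g t" using g_A(1)[OF True] \<rho>_abs(1)[of t] m by simp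
      also have "\<dots> \<le> real n * g t" using \<rho>_abs(2)[of t] n g1[of t] by (intro mult_right_mono) auto
      finally show ?thesis .
    next
      case False
      then show ?thesis using w_off[of t] by (auto simp: g_def A_def)
    qed
    obtain z where z: "z \<in> Lip {0..1}" "z 0 = y 0"
      "action L z \<le> (\<integral>\<^sup>+t. ennreal (g t) * L (y t, w t / g t) * indicator {0..1} t \<partial>lborel)"
      by (rule lipschitz_reparametrization[OF L conty w w_der w_int g_meas g1 off g_int w_le])
    have "(INF z\<in>{z \<in> Lip {0..1}. z 0 = y 0}. action L z) \<le> action L z"
      using z by (intro INF_lower) auto
    also note z(3)
    \<comment> \<open>Off \<open>A\<close> the integrand is that of \<open>y\<close>. On
      \<open>A\<close> the velocity argument of \<open>L\<close> is one of the two fields, so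
      \<open>L\<close> is at most \<open>B\<close>, and \<open>g\<close> is at most the speed over
      \<open>m\<close>.\<close>
    also have "(\<integral>\<^sup>+t. ennreal (g t) * L (y t, w t / g t) * indicator {0..1} t \<partial>lborel) \<le>
        (\<integral>\<^sup>+t. L (yc t, w t) * indicator {0..1} t
           + B * ennreal (1 / m) * (ennreal \<bar>w t\<bar> * indicator {t. real n < \<bar>w t\<bar>} t) \<partial>lborel)"
    proof (rule nn_integral_mono)
      fix t :: real
      show "ennreal (g t) * L (y t, w t / g t) * indicator {0..1} t \<le> L (yc t, w t) * indicator {0..1} t
           + B * ennreal (1 / m) * (ennreal \<bar>w t\<bar> * indicator {t. real n < \<bar>w t\<bar>} t)"
      proof (cases "t \<in> A")
        case True
        then have t: "t \<in> {0..1}" "real n < \<bar>w t\<bar>" by (auto simp: A_def)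
        have "L (y t, w t / g t) \<le> B"
          using B[OF ycR[of t]] g_A(3)[OF True] yc[OF t(1)] by (auto simp: \<rho>_def)
        moreover have "ennreal (g t) \<le> ennreal \<bar>w t\<bar> * ennreal (1 / m)"
          using g_le[OF True] by (simp add: ennreal_mult'[symmetric] ennreal_leI)
        ultimately have "ennreal (g t) * L (y t, w t / g t) \<le> (ennreal \<bar>w t\<bar> * ennreal (1 / m)) * B"
          by (intro mult_mono) auto
        also have "\<dots> = B * ennreal (1 / m) * ennreal \<bar>w t\<bar>" by (simp only: mult_ac)
        finally show ?thesis using t by (simp add: add_increasing)
      next
        case False
        then have "g t = 1" by (simp add: g_def)
        then show ?thesis using yc[of t] by (auto split: split_indicator simp: add_increasing2)
      qed
    qed
    also have "\<dots> = (\<integral>\<^sup>+t. L (yc t, w t) * indicator {0..1} t \<partial>lborel) + B * ennreal (1 / m) * tail n"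
      using L unfolding tail_def by (subst nn_integral_add) (auto simp: nn_integral_cmult)
    also have "(\<integral>\<^sup>+t. L (yc t, w t) * indicator {0..1} t \<partial>lborel) = (\<integral>\<^sup>+t. L (y t, w t) * indicator {0..1} t \<partial>lborel)"
      by (rule nn_integral_cong) (auto split: split_indicator simp: yc)
    also have "\<dots> = action L y"
      by (rule action_eq_nn_integral_lborel[symmetric]) (use w_der in \<open>auto elim!: eventually_mono intro: DERIV_imp_deriv\<close>)
    finally show ?thesis .
  qed
  \<comment> \<open>The factor in front of the tail must be finite for the product to tend to
    \<open>0\<close>; here the boundedness of \<open>L\<close> along the two fields enters.\<close>
  have "(\<lambda>n. action L y + B * ennreal (1 / m) * tail n) \<longlonglongrightarrow> action L y + B * ennreal (1 / m) * 0"
  proof (rule tendsto_add[OF tendsto_const ennreal_tendsto_cmult])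
    show "B * ennreal (1 / m) < top" using B_fin by (simp add: ennreal_mult_less_top less_top)
    show "tail \<longlonglongrightarrow> 0" unfolding tail_def[abs_def] by (rule tendsto_nn_integral_tail[OF w_integrable])
  qed
  then have lim: "(\<lambda>n. action L y + B * ennreal (1 / m) * tail n) \<longlonglongrightarrow> action L y" by simp
  obtain N where N: "K \<le> real N" using real_arch_simple by blast
  show ?thesis
  proof (rule LIMSEQ_le_const[OF lim], intro exI[of _ N] allI impI)
    show "(INF z\<in>{z \<in> Lip {0..1}. z 0 = y 0}. action L z) \<le> action L y + B * ennreal (1 / m) * tail n" if "N \<le> n" for n
      using N that by (intro bound) (meson of_nat_mono order_trans)
  qed
qed

section \<open>Equality of the two infima\<close>

theorem corollary4p5:
  fixes L :: "real \<times> real \<Rightarrow> ennreal"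
    and \<rho>m \<rho>p :: "real \<Rightarrow> real"
  assumes "L \<in> borel_measurable borel"
    and "local_lipschitz (UNIV :: real set) UNIV (\<lambda>_. \<rho>m)"
    and "local_lipschitz (UNIV :: real set) UNIV (\<lambda>_. \<rho>p)"
    and "\<And>z. \<rho>m z < 0"
    and "\<And>z. \<rho>p z > 0"
    and "\<And>J. is_interval J \<Longrightarrow> bounded J \<Longrightarrow> (SUP z\<in>J. L (z, \<rho>m z)) < \<infinity>"
    and "\<And>J. is_interval J \<Longrightarrow> bounded J \<Longrightarrow> (SUP z\<in>J. L (z, \<rho>p z)) < \<infinity>"
  shows "(INF y\<in>{y \<in> W11 {0..1}. y 0 = 0}. action L y) =
         (INF y\<in>{y \<in> Lip {0..1}. y 0 = 0}. action L y)"
proof (rule antisym)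
  show "(INF y\<in>{y \<in> W11 {0..1}. y 0 = 0}. action L y) \<le> (INF y\<in>{y \<in> Lip {0..1}. y 0 = 0}. action L y)"
    by (rule INF_superset_mono) (use Lip_subset_W11 in auto)
  have "continuous_on UNIV \<rho>m" "continuous_on UNIV \<rho>p"
    using local_lipschitz_continuous_on[OF assms(2)] local_lipschitz_continuous_on[OF assms(3)] by auto
  \<comment> \<open>The approximating curves start at \<open>y 0\<close>, so they remain admissible
    for the constraint at \<open>0\<close>.\<close>
  note approx = lipschitz_approximation[OF assms(1) this assms(4-7)]
  show "(INF y\<in>{y \<in> Lip {0..1}. y 0 = 0}. action L y) \<le> (INF y\<in>{y \<in> W11 {0..1}. y 0 = 0}. action L y)"
    by (rule INF_greatest) (use approx in force)
qed

end
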